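(* Let $G$ be a dynamic graph, $\mathcal{P}$ a connected graph on four vertices, and $\gamma>0$ a small constant. There is no incremental or fully dynamic combinatorial algorithm with preprocessing time $O(m^{2-\gamma})$ that maintains $\mathbf{c_I}(G,\mathcal{P})$ in amortized update time $O(m^{1-\gamma})$ and query time $O(m^{2-\gamma})$, unless the Combinatorial $k$-Clique Conjecture fails (for $k=4$).
   Context: A dynamic graph is a simple undirected graph on a fixed vertex set of $n$ vertices undergoing edge updates (only insertions for incremental algorithms; insertions and deletions for fully dynamic ones); $m$ is the current number of edges. $\mathbf{c_I}(G,\mathcal{P})$ is the number of induced subgraphs of $G$ isomorphic to $\mathcal{P}$. Combinatorial $k$-Clique Conjecture: for any constant $\delta>0$, there is no $O(n^{k-\delta})$-time combinatorial algorithm that detects whether an $n$-vertex graph contains a $k$-clique with error probability at most $1/3$ in the word-RAM model with $O(\log n)$-bit words. *)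

theory Defs
  imports "HOL-Probability.Probability" "HOL-Library.Log_Nat"
begin

section \<open>Simple undirected graphs\<close>

type_synonym 'a graph = "'a set \<times> 'a set set"

abbreviation verts :: "'a graph \<Rightarrow> 'a set" where "verts G \<equiv> fst G"
abbreviation edges :: "'a graph \<Rightarrow> 'a set set" where "edges G \<equiv> snd G"

definition simple_graph :: "'a graph \<Rightarrow> bool" where
  "simple_graph G \<longleftrightarrow> finite (verts G) \<and> (\<forall>e\<in>edges G. e \<subseteq> verts G \<and> card e = 2)"

definition connected_graph :: "'a graph \<Rightarrow> bool" where
  "connected_graph G \<longleftrightarrow> verts G \<noteq> {} \<and>
     (\<forall>u\<in>verts G. \<forall>v\<in>verts G. (u, v) \<in> {(x, y). {x, y} \<in> edges G}\<^sup>*)"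

definition isomorphic :: "'a graph \<Rightarrow> 'b graph \<Rightarrow> bool" where
  "isomorphic G H \<longleftrightarrow> (\<exists>f. bij_betw f (verts G) (verts H) \<and>
     (\<forall>u\<in>verts G. \<forall>v\<in>verts G. {u, v} \<in> edges G \<longleftrightarrow> {f u, f v} \<in> edges H))"

definition induced_subgraph :: "'a graph \<Rightarrow> 'a set \<Rightarrow> 'a graph" where
  "induced_subgraph G S = (S, {e \<in> edges G. e \<subseteq> S})"

definition c_I :: "'a graph \<Rightarrow> 'b graph \<Rightarrow> nat" where
  "c_I G P = card {S. S \<subseteq> verts G \<and> isomorphic (induced_subgraph G S) P}"

definition has_clique :: "nat \<Rightarrow> 'a graph \<Rightarrow> bool" where
  "has_clique k G \<longleftrightarrow> (\<exists>S. S \<subseteq> verts G \<and> finite S \<and> card S = k \<and>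
     (\<forall>u\<in>S. \<forall>v\<in>S. u \<noteq> v \<longrightarrow> {u, v} \<in> edges G))"

section \<open>Randomised word RAM\<close>

text \<open>
  Words of \<open>w\<close> bits are naturals below \<open>2 ^ w\<close>.  A program is a structured (while-)program over
  finitely many registers and a word-addressed memory; every instruction and every branch test
  takes one time step.
\<close>

datatype binop = Add | Sub | Mul | Div | Mod | And | Or | Xor | Shl | Shr | Less | Equal

fun binop_val :: "nat \<Rightarrow> binop \<Rightarrow> nat \<Rightarrow> nat \<Rightarrow> nat" where
  "binop_val w Add a b = (a + b) mod 2 ^ w"
| "binop_val w Sub a b = (a + 2 ^ w - b) mod 2 ^ w"
| "binop_val w Mul a b = (a * b) mod 2 ^ w"
| "binop_val w Div a b = (a div b) mod 2 ^ w"
| "binop_val w Mod a b = (a mod b) mod 2 ^ w"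
| "binop_val w And a b = (Bit_Operations.and a b) mod 2 ^ w"
| "binop_val w Or a b = (Bit_Operations.or a b) mod 2 ^ w"
| "binop_val w Xor a b = (Bit_Operations.xor a b) mod 2 ^ w"
| "binop_val w Shl a b = (a * 2 ^ b) mod 2 ^ w"
| "binop_val w Shr a b = (a div 2 ^ b) mod 2 ^ w"
| "binop_val w Less a b = (of_bool (a < b)) mod 2 ^ w"
| "binop_val w Equal a b = (of_bool (a = b)) mod 2 ^ w"

datatype com =
    Skip
  | Const nat nat
  | Op binop nat nat nat
  | Load nat nat
  | Store nat nat
  | Rand nat
  | Seq com com
  | IfNZ nat com com
  | WhileNZ nat com

record state =
  reg :: "nat \<Rightarrow> nat"
  mem :: "nat \<Rightarrow> nat"
  coins :: "bool stream"

definition set_reg :: "nat \<Rightarrow> nat \<Rightarrow> state \<Rightarrow> state" where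
  "set_reg x a s = s\<lparr>reg := (reg s)(x := a)\<rparr>"

text \<open>
  \<open>exec w c s t s'\<close>: started in \<open>s\<close>, the program \<open>c\<close> halts in \<open>s'\<close> after exactly \<open>t\<close> steps.
  \<open>Rand\<close> consumes the next \<open>w\<close> coin flips, i.e. draws a uniformly random word.
\<close>

inductive exec :: "nat \<Rightarrow> com \<Rightarrow> state \<Rightarrow> nat \<Rightarrow> state \<Rightarrow> bool" for w where
  exec_Skip: "exec w Skip s 1 s"
| exec_Const: "exec w (Const x a) s 1 (set_reg x (a mod 2 ^ w) s)"
| exec_Op: "exec w (Op f x y z) s 1 (set_reg x (binop_val w f (reg s y) (reg s z)) s)"
| exec_Load: "exec w (Load x y) s 1 (set_reg x (mem s (reg s y)) s)"
| exec_Store: "exec w (Store x y) s 1 (s\<lparr>mem := (mem s)(reg s x := reg s y)\<rparr>)"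
| exec_Rand: "exec w (Rand x) s 1
    ((set_reg x (horner_sum of_bool 2 (stake w (coins s))) s)\<lparr>coins := sdrop w (coins s)\<rparr>)"
| exec_Seq: "exec w c\<^sub>1 s t\<^sub>1 s' \<Longrightarrow> exec w c\<^sub>2 s' t\<^sub>2 s'' \<Longrightarrow> exec w (Seq c\<^sub>1 c\<^sub>2) s (t\<^sub>1 + t\<^sub>2) s''"
| exec_IfT: "reg s x \<noteq> 0 \<Longrightarrow> exec w c\<^sub>1 s t s' \<Longrightarrow> exec w (IfNZ x c\<^sub>1 c\<^sub>2) s (Suc t) s'"
| exec_IfF: "reg s x = 0 \<Longrightarrow> exec w c\<^sub>2 s t s' \<Longrightarrow> exec w (IfNZ x c\<^sub>1 c\<^sub>2) s (Suc t) s'"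
| exec_WhileF: "reg s x = 0 \<Longrightarrow> exec w (WhileNZ x c) s 1 s"
| exec_WhileT: "reg s x \<noteq> 0 \<Longrightarrow> exec w c s t\<^sub>1 s' \<Longrightarrow> exec w (WhileNZ x c) s' t\<^sub>2 s'' \<Longrightarrow>
    exec w (WhileNZ x c) s (Suc (t\<^sub>1 + t\<^sub>2)) s''"

definition coin_space :: "bool stream measure" where
  "coin_space = stream_space (measure_pmf (pmf_of_set UNIV))"

definition word_size :: "nat \<Rightarrow> nat \<Rightarrow> nat" where
  "word_size \<kappa> n = \<kappa> * floorlog 2 n"

text \<open>
  A graph on \<open>{..<n}\<close> is given by \<open>n\<close>, the number of edges, its edges in an arbitrary order and
  orientation, and its adjacency matrix.  Having both representations, an algorithm can enumerate
  the edges in time proportional to their number and test adjacency in constant time.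
\<close>

definition graph_on :: "nat \<Rightarrow> nat set set \<Rightarrow> bool" where
  "graph_on n E \<longleftrightarrow> simple_graph ({..<n}, E)"

definition edge_listing :: "(nat \<times> nat) list \<Rightarrow> nat set set \<Rightarrow> bool" where
  "edge_listing es E \<longleftrightarrow> bij_betw (\<lambda>i. {fst (es ! i), snd (es ! i)}) {..<length es} E"

definition encode_graph :: "nat \<Rightarrow> (nat \<times> nat) list \<Rightarrow> nat list" where
  "encode_graph n es = [n, length es] @ concat (map (\<lambda>(u, v). [u, v]) es) @
     concat (map (\<lambda>u. map (\<lambda>v. of_bool ((u, v) \<in> set es \<or> (v, u) \<in> set es)) [0..<n]) [0..<n])"

definition init_state :: "nat \<Rightarrow> (nat \<times> nat) list \<Rightarrow> bool stream \<Rightarrow> state" where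
  "init_state n es \<omega> =
     \<lparr>reg = (\<lambda>_. 0),
      mem = (\<lambda>a. if a < length (encode_graph n es) then encode_graph n es ! a else 0),
      coins = \<omega>\<rparr>"

section \<open>Combinatorial algorithms\<close>

text \<open>
  There is no generally accepted definition of a combinatorial algorithm, so the notion is kept as
  a parameter: a set of programs subject only to two closure properties.  Deterministic programs
  that never write to memory, i.e. that work in a constant number of registers on a read-only
  input, count as combinatorial, and running one combinatorial program after another is
  combinatorial.  Closure under all program constructors must not be demanded: it would make
  every program combinatorial, including those based on fast matrix multiplication.
\<close>

fun register_only :: "com \<Rightarrow> bool" where
  "register_only (Store x y) = False"
| "register_only (Rand x) = False"
| "register_only (Seq c\<^sub>1 c\<^sub>2) = (register_only c\<^sub>1 \<and> register_only c\<^sub>2)"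
| "register_only (IfNZ x c\<^sub>1 c\<^sub>2) = (register_only c\<^sub>1 \<and> register_only c\<^sub>2)"
| "register_only (WhileNZ x c) = register_only c"
| "register_only _ = True"

definition combinatorial_notion :: "com set \<Rightarrow> bool" where
  "combinatorial_notion \<C> \<longleftrightarrow>
     (\<forall>c. register_only c \<longrightarrow> c \<in> \<C>) \<and> (\<forall>c\<^sub>1\<in>\<C>. \<forall>c\<^sub>2\<in>\<C>. Seq c\<^sub>1 c\<^sub>2 \<in> \<C>)"

section \<open>The combinatorial clique conjecture\<close>

text \<open>
  Words have \<open>\<kappa> * floorlog 2 n\<close> bits for a constant \<open>\<kappa>\<close> of the algorithm's choice.  Requiring
  \<open>4 \<le> \<kappa>\<close> makes every input address, and every number of four-vertex subgraphs, fit in one word.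
  The answer of a program is read from register 0.
\<close>

definition detects_clique :: "nat \<Rightarrow> nat \<Rightarrow> com \<Rightarrow> real \<Rightarrow> bool" where
  "detects_clique k \<kappa> c e \<longleftrightarrow> (\<exists>C. \<forall>n\<ge>1. \<forall>E es. graph_on n E \<and> edge_listing es E \<longrightarrow>
     (\<forall>\<omega>. \<exists>t s. exec (word_size \<kappa> n) c (init_state n es \<omega>) t s \<and> real t \<le> C * real n powr e) \<and>
     measure coin_space {\<omega>. \<exists>t s. exec (word_size \<kappa> n) c (init_state n es \<omega>) t s \<and>
       (reg s 0 \<noteq> 0 \<longleftrightarrow> has_clique k ({..<n}, E))} \<ge> 2 / 3)"

definition combinatorial_clique_conjecture :: "com set \<Rightarrow> nat \<Rightarrow> bool" where
  "combinatorial_clique_conjecture \<C> k \<longleftrightarrow>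
     (\<forall>\<delta>>0. \<not> (\<exists>\<kappa>\<ge>4. \<exists>c\<in>\<C>. detects_clique k \<kappa> c (real k - \<delta>)))"

section \<open>Dynamic algorithms\<close>

datatype opn = Insert nat nat | Delete nat nat | Query

datatype dyn_mode = Incremental | Fully_Dynamic

fun is_update :: "opn \<Rightarrow> bool" where
  "is_update Query = False"
| "is_update _ = True"

fun apply_op :: "nat set set \<Rightarrow> opn \<Rightarrow> nat set set" where
  "apply_op E (Insert u v) = insert {u, v} E"
| "apply_op E (Delete u v) = E - {{u, v}}"
| "apply_op E Query = E"

text \<open>The graph right after operation number \<open>i\<close>.\<close>

definition graph_after :: "nat set set \<Rightarrow> opn list \<Rightarrow> nat \<Rightarrow> nat set set" where
  "graph_after E ops i = foldl apply_op E (take (Suc i) ops)"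

fun valid_op :: "dyn_mode \<Rightarrow> nat \<Rightarrow> nat set set \<Rightarrow> opn \<Rightarrow> bool" where
  "valid_op md n E (Insert u v) = (u < n \<and> v < n \<and> u \<noteq> v \<and> {u, v} \<notin> E)"
| "valid_op md n E (Delete u v) = (md = Fully_Dynamic \<and> {u, v} \<in> E)"
| "valid_op md n E Query = True"

fun valid_ops :: "dyn_mode \<Rightarrow> nat \<Rightarrow> nat set set \<Rightarrow> opn list \<Rightarrow> bool" where
  "valid_ops md n E [] = True"
| "valid_ops md n E (p # ops) = (valid_op md n E p \<and> valid_ops md n (apply_op E p) ops)"

text \<open>For incremental algorithms the component \<open>del\<close> is never executed.\<close>

record dyn_alg =
  pre :: com
  ins :: com
  del :: com
  qry :: com

definition combinatorial_dyn :: "com set \<Rightarrow> dyn_alg \<Rightarrow> bool" where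
  "combinatorial_dyn \<C> A \<longleftrightarrow> pre A \<in> \<C> \<and> ins A \<in> \<C> \<and> del A \<in> \<C> \<and> qry A \<in> \<C>"

fun prog_of :: "dyn_alg \<Rightarrow> opn \<Rightarrow> com" where
  "prog_of A (Insert u v) = ins A"
| "prog_of A (Delete u v) = del A"
| "prog_of A Query = qry A"

text \<open>
  The whole machine state persists between operations; the endpoints of an updated edge are
  passed in registers 0 and 1.
\<close>

fun call :: "opn \<Rightarrow> state \<Rightarrow> state" where
  "call (Insert u v) s = set_reg 1 v (set_reg 0 u s)"
| "call (Delete u v) s = set_reg 1 v (set_reg 0 u s)"
| "call Query s = s"

text \<open>The last argument lists, for each operation, its running time and final register 0.\<close>

inductive runs :: "nat \<Rightarrow> dyn_alg \<Rightarrow> state \<Rightarrow> opn list \<Rightarrow> (nat \<times> nat) list \<Rightarrow> bool" for w A where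
  runs_Nil: "runs w A s [] []"
| runs_Cons: "exec w (prog_of A p) (call p s) t s' \<Longrightarrow> runs w A s' ops rs \<Longrightarrow>
    runs w A s (p # ops) ((t, reg s' 0) # rs)"

text \<open>A run on initial edges \<open>es\<close>: preprocessing takes \<open>t\<close> steps, the operations behave as \<open>rs\<close>.\<close>

definition session ::
  "nat \<Rightarrow> dyn_alg \<Rightarrow> nat \<Rightarrow> (nat \<times> nat) list \<Rightarrow> opn list \<Rightarrow> bool stream \<Rightarrow> nat \<Rightarrow> (nat \<times> nat) list \<Rightarrow> bool"
  where
  "session w A n es ops \<omega> t rs \<longleftrightarrow>
     (\<exists>s. exec w (pre A) (init_state n es \<omega>) t s \<and> runs w A s ops rs)"

text \<open>
  Since \<open>0 powr e = 0\<close>, a bound in the number \<open>m\<close> of edges is read with \<open>max 1 m\<close>, so that a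
  constant number of steps is still allowed on an edgeless graph.
\<close>

definition m_bound :: "nat set set \<Rightarrow> real \<Rightarrow> real" where
  "m_bound E e = real (max 1 (card E)) powr e"

text \<open>
  Preprocessing time \<open>O(m powr ep)\<close>, amortised update time \<open>O(m powr eu)\<close> and query time
  \<open>O(m powr eq)\<close> for every outcome of the coin flips; every single query is answered correctly with
  probability at least \<open>2/3\<close>.
\<close>

definition maintains_c_I ::
  "dyn_mode \<Rightarrow> 'b graph \<Rightarrow> nat \<Rightarrow> dyn_alg \<Rightarrow> real \<Rightarrow> real \<Rightarrow> real \<Rightarrow> bool" where
  "maintains_c_I md P \<kappa> A ep eu eq \<longleftrightarrow> (\<exists>C. \<forall>n\<ge>1. \<forall>E es ops.
     graph_on n E \<and> edge_listing es E \<and> valid_ops md n E ops \<longrightarrow>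
     (\<forall>\<omega>. \<exists>t rs. session (word_size \<kappa> n) A n es ops \<omega> t rs \<and>
        real t \<le> C * m_bound E ep \<and>
        (\<Sum>i | i < length ops \<and> is_update (ops ! i). real (fst (rs ! i)))
          \<le> C * (\<Sum>i | i < length ops \<and> is_update (ops ! i). m_bound (graph_after E ops i) eu) \<and>
        (\<forall>i<length ops. ops ! i = Query \<longrightarrow>
           real (fst (rs ! i)) \<le> C * m_bound (graph_after E ops i) eq)) \<and>
     (\<forall>i<length ops. ops ! i = Query \<longrightarrow>
        measure coin_space {\<omega>. \<exists>t rs. session (word_size \<kappa> n) A n es ops \<omega> t rs \<and>
          snd (rs ! i) = c_I ({..<n}, graph_after E ops i) P} \<ge> 2 / 3))"

end

theory Submission
  imports Defs
begin

text \<open>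
  No update is needed: preprocessing the input graph and asking a single query already decides
  whether it contains a 4-clique.  For a four-vertex graph \<open>P\<close> with a missing edge \<open>e\<close>, an embedding of
  \<open>P\<close> or of \<open>P + e\<close> is an embedding in which the pair \<open>e\<close> is unconstrained; once the images of the
  two other vertices are fixed, the images of the ends of \<open>e\<close> vary independently, so these embeddings
  can be counted in time \<open>O(n\<^sup>3)\<close>.  Adding the missing edges one by one shows that the number of
  embeddings of \<open>P\<close>, which is \<open>|Aut P|\<close> times the induced subgraph count, equals a quantity
  computable in cubic time plus or minus the number of embeddings of the 4-clique.  As there are at most
  \<open>n\<^sup>4\<close> of the latter, they can be detected in arithmetic modulo \<open>2 ^ w\<close>.
\<close>

section \<open>Word RAM computations\<close>

text \<open>The obstacle is how little \<open>combinatorial_notion\<close> grants: register-only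
  deterministic programs and sequential composition. The dynamic algorithm is therefore never placed
  under a branch or in a loop, and the counting code keeps no tables; it has a constant number of
  registers and the adjacency matrix of the input. With \<open>D\<close> the cubic-time quantity,
  adding an edge e reads emb(P) = D - emb(P + e), so the sign of the clique term flips once per
  missing edge; this is the origin of \<open>\<sigma>\<close>. The answer of the query is multiplied
  by |Aut P|, since dividing by a possibly even number makes no sense modulo \<open>2 ^ w\<close>.
  Bounds in m become bounds in n through m \<le> n^2, which doubles the exponent and turns a saving
  of \<gamma> into one of 2 \<gamma>. Error probabilities are transferred outcome by outcome: the
  added code flips no coins, so the same coin sequence that makes the query correct makes the clique
  answer correct.\<close>

fun reg_bound :: "com \<Rightarrow> nat" where
  "reg_bound Skip = 0"
| "reg_bound (Const x a) = Suc x"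
| "reg_bound (Op f x y z) = Suc (max x (max y z))"
| "reg_bound (Load x y) = Suc (max x y)"
| "reg_bound (Store x y) = Suc (max x y)"
| "reg_bound (Rand x) = Suc x"
| "reg_bound (Seq c\<^sub>1 c\<^sub>2) = max (reg_bound c\<^sub>1) (reg_bound c\<^sub>2)"
| "reg_bound (IfNZ x c\<^sub>1 c\<^sub>2) = max (Suc x) (max (reg_bound c\<^sub>1) (reg_bound c\<^sub>2))"
| "reg_bound (WhileNZ x c) = max (Suc x) (reg_bound c)"

section \<open>Registers that a program does not mention\<close>

lemma state_eqI:
  "reg s = reg s' \<Longrightarrow> mem s = mem s' \<Longrightarrow> coins s = coins s' \<Longrightarrow> s = (s' :: state)"
  by (rule state.equality) auto

definition override_from :: "nat \<Rightarrow> (nat \<Rightarrow> nat) \<Rightarrow> state \<Rightarrow> state" where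
  "override_from B g s = s\<lparr>reg := (\<lambda>x. if x < B then reg s x else g x)\<rparr>"

lemma override_from_set_reg:
  "x < B \<Longrightarrow> override_from B g (set_reg x a s) = set_reg x a (override_from B g s)"
  by (rule state_eqI) (auto simp: override_from_def set_reg_def)

lemma override_from_simps [simp]:
  "x < B \<Longrightarrow> reg (override_from B g s) x = reg s x"
  "\<not> x < B \<Longrightarrow> reg (override_from B g s) x = g x"
  "mem (override_from B g s) = mem s"
  "coins (override_from B g s) = coins s"
  by (auto simp: override_from_def)

text \<open>Frame rule: every register that \<open>c\<close> reads or writes lies below
  \<open>B\<close>, so each step commutes with replacing the registers from \<open>B\<close> on.
  This is what lets a value parked there survive a run of the dynamic algorithm.\<close>

lemma exec_override_from:
  assumes "exec w c s t s'" and "reg_bound c \<le> B"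
  shows "exec w c (override_from B g s) t (override_from B g s')"
  using assms
proof (induction rule: exec.induct)
  case (exec_Const x a s)
  then show ?case
    using exec.exec_Const[of w x a "override_from B g s"] by (simp add: override_from_set_reg)
next
  case (exec_Op f x y z s)
  then show ?case
    using exec.exec_Op[of w f x y z "override_from B g s"] by (simp add: override_from_set_reg)
next
  case (exec_Load x y s)
  then show ?case
    using exec.exec_Load[of w x y "override_from B g s"] by (simp add: override_from_set_reg)
next
  case (exec_Store x y s)
  have "override_from B g (s\<lparr>mem := (mem s)(reg s x := reg s y)\<rparr>) =
        (override_from B g s)\<lparr>mem := (mem s)(reg s x := reg s y)\<rparr>"
    by (rule state_eqI) (auto simp: override_from_def)
  then show ?case
    using exec.exec_Store[of w x y "override_from B g s"] exec_Store by simp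
next
  case (exec_Rand x s)
  have "override_from B g
      ((set_reg x (horner_sum of_bool 2 (stake w (coins s))) s)\<lparr>coins := sdrop w (coins s)\<rparr>) =
      (set_reg x (horner_sum of_bool 2 (stake w (coins s))) (override_from B g s))
        \<lparr>coins := sdrop w (coins s)\<rparr>"
    using exec_Rand by (intro state_eqI) (auto simp: override_from_def set_reg_def)
  then show ?case
    using exec.exec_Rand[of w x "override_from B g s"] by simp
qed (auto intro: exec.intros exec_Skip[simplified] exec_WhileF[simplified])

section \<open>Coins consumed by a halting computation\<close>

lemma stake_add_eqD:
  assumes "stake (m + k) a = stake (m + k) b"
  shows "stake m a = stake m b" and "stake k (sdrop m a) = stake k (sdrop m b)"
  using assms by (simp_all flip: stake_add add: append_eq_append_conv)

lemma set_reg_coins: "set_reg x a (s\<lparr>coins := \<omega>\<rparr>) = (set_reg x a s)\<lparr>coins := \<omega>\<rparr>"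
  and mem_coins: "s\<lparr>coins := \<omega>, mem := f\<rparr> = s\<lparr>mem := f, coins := \<omega>\<rparr>"
  and coins_set_reg [simp]: "coins (set_reg x a s) = coins s"
  by (auto intro: state_eqI simp: set_reg_def)

text \<open>Only \<open>Rand\<close> touches the coins, and it takes \<open>w\<close> of them in one
  step, so \<open>t\<close> steps see at most the first \<open>w * t\<close>. The surplus
  \<open>N\<close> records how far the unread streams still agree; without it the induction could
  not pass from one command to the next.\<close>

lemma exec_coins_prefix:
  assumes "exec w c s t s'" and "stake (w * t + N) (coins s) = stake (w * t + N) \<omega>"
  shows "\<exists>\<omega>'. exec w c (s\<lparr>coins := \<omega>\<rparr>) t (s'\<lparr>coins := \<omega>'\<rparr>) \<and> stake N (coins s') = stake N \<omega>'"
  using assms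
proof (induction arbitrary: N \<omega> rule: exec.induct)
  case (exec_Skip s)
  then show ?case
    by (intro exI[of _ \<omega>] conjI exec.exec_Skip)
      (auto dest: stake_add_eqD(1)[of N w, unfolded add.commute[of N w]])
next
  case (exec_Const x a s)
  then show ?case
    using exec.exec_Const[of w x a "s\<lparr>coins := \<omega>\<rparr>"]
    by (intro exI[of _ \<omega>])
      (auto simp: set_reg_coins mem_coins dest: stake_add_eqD(1)[of N w, unfolded add.commute[of N w]])
next
  case (exec_Op f x y z s)
  then show ?case
    using exec.exec_Op[of w f x y z "s\<lparr>coins := \<omega>\<rparr>"]
    by (intro exI[of _ \<omega>])
      (auto simp: set_reg_coins mem_coins dest: stake_add_eqD(1)[of N w, unfolded add.commute[of N w]])
next
  case (exec_Load x y s)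
  then show ?case
    using exec.exec_Load[of w x y "s\<lparr>coins := \<omega>\<rparr>"]
    by (intro exI[of _ \<omega>])
      (auto simp: set_reg_coins mem_coins dest: stake_add_eqD(1)[of N w, unfolded add.commute[of N w]])
next
  case (exec_Store x y s)
  then show ?case
    using exec.exec_Store[of w x y "s\<lparr>coins := \<omega>\<rparr>"]
    by (intro exI[of _ \<omega>])
      (auto simp: set_reg_coins mem_coins dest: stake_add_eqD(1)[of N w, unfolded add.commute[of N w]])
next
  case (exec_Rand x s)
  then have "stake w (coins s) = stake w \<omega>" "stake N (sdrop w (coins s)) = stake N (sdrop w \<omega>)"
    using stake_add_eqD[of w N] by auto
  then show ?case
    using exec.exec_Rand[of w x "s\<lparr>coins := \<omega>\<rparr>"]
    by (intro exI[of _ "sdrop w \<omega>"]) (auto simp: set_reg_coins)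
next
  case (exec_Seq c\<^sub>1 s t\<^sub>1 s' c\<^sub>2 t\<^sub>2 s'')
  have "stake (w * t\<^sub>1 + (w * t\<^sub>2 + N)) (coins s) = stake (w * t\<^sub>1 + (w * t\<^sub>2 + N)) \<omega>"
    using exec_Seq.prems by (simp add: algebra_simps)
  from exec_Seq.IH(1)[OF this] obtain \<omega>' where
    1: "exec w c\<^sub>1 (s\<lparr>coins := \<omega>\<rparr>) t\<^sub>1 (s'\<lparr>coins := \<omega>'\<rparr>)"
       "stake (w * t\<^sub>2 + N) (coins s') = stake (w * t\<^sub>2 + N) \<omega>'" by blast
  from exec_Seq.IH(2)[OF 1(2)] 1(1) show ?case by (blast intro: exec.exec_Seq)
next
  case (exec_IfT s x c\<^sub>1 t s' c\<^sub>2)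
  \<comment> \<open>The branch test costs a step but reads no coins, so its share \<open>w\<close>
    of the budget moves into the surplus.\<close>
  have "stake (w * t + (N + w)) (coins s) = stake (w * t + (N + w)) \<omega>"
    using exec_IfT.prems by (simp add: algebra_simps)
  from exec_IfT.IH[OF this] obtain \<omega>' where
    1: "exec w c\<^sub>1 (s\<lparr>coins := \<omega>\<rparr>) t (s'\<lparr>coins := \<omega>'\<rparr>)"
       "stake (N + w) (coins s') = stake (N + w) \<omega>'" by blast
  then show ?case
    using stake_add_eqD(1)[OF 1(2)] exec_IfT.hyps by (auto intro!: exI[of _ \<omega>'] exec.exec_IfT)
next
  case (exec_IfF s x c\<^sub>2 t s' c\<^sub>1)
  have "stake (w * t + (N + w)) (coins s) = stake (w * t + (N + w)) \<omega>"
    using exec_IfF.prems by (simp add: algebra_simps)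
  from exec_IfF.IH[OF this] obtain \<omega>' where
    1: "exec w c\<^sub>2 (s\<lparr>coins := \<omega>\<rparr>) t (s'\<lparr>coins := \<omega>'\<rparr>)"
       "stake (N + w) (coins s') = stake (N + w) \<omega>'" by blast
  then show ?case
    using stake_add_eqD(1)[OF 1(2)] exec_IfF.hyps by (auto intro!: exI[of _ \<omega>'] exec.exec_IfF)
next
  case (exec_WhileF s x c)
  then show ?case
    by (intro exI[of _ \<omega>] conjI exec.exec_WhileF)
      (auto dest: stake_add_eqD(1)[of N w, unfolded add.commute[of N w]])
next
  case (exec_WhileT s x c t\<^sub>1 s' t\<^sub>2 s'')
  have "stake (w * t\<^sub>1 + (w * t\<^sub>2 + (N + w))) (coins s) =
        stake (w * t\<^sub>1 + (w * t\<^sub>2 + (N + w))) \<omega>"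
    using exec_WhileT.prems by (simp add: algebra_simps)
  from exec_WhileT.IH(1)[OF this] obtain \<omega>' where
    1: "exec w c (s\<lparr>coins := \<omega>\<rparr>) t\<^sub>1 (s'\<lparr>coins := \<omega>'\<rparr>)"
       "stake (w * t\<^sub>2 + (N + w)) (coins s') = stake (w * t\<^sub>2 + (N + w)) \<omega>'" by blast
  from exec_WhileT.IH(2)[OF 1(2)] obtain \<omega>'' where
    2: "exec w (WhileNZ x c) (s'\<lparr>coins := \<omega>'\<rparr>) t\<^sub>2 (s''\<lparr>coins := \<omega>''\<rparr>)"
       "stake (N + w) (coins s'') = stake (N + w) \<omega>''" by blast
  then show ?case
    using stake_add_eqD(1)[OF 2(2)] exec_WhileT.hyps 1(1)
    by (auto intro!: exI[of _ \<omega>''] exec.exec_WhileT)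
qed

lemma space_coin_space [simp]: "space coin_space = UNIV"
  by (simp add: coin_space_def space_stream_space)

text \<open>A halting computation of \<open>t\<close> steps reads at most \<open>w * t\<close> coins, so each \<open>t\<close> contributes a
  cylinder set.\<close>
lemma sets_coin_space_exec_outcome:
  "{\<omega>. \<exists>t s. exec w c (init_state n es \<omega>) t s \<and> Q (reg s 0)} \<in> sets coin_space"
proof -
  define Z where "Z t = {\<omega>. \<exists>s. exec w c (init_state n es \<omega>) t s \<and> Q (reg s 0)}" for t
  have "Z t \<in> sets coin_space" for t
  proof -
    have "Z t = stake (w * t) -` (stake (w * t) ` Z t) \<inter> space coin_space"
    proof (intro equalityI subsetI)
      fix \<omega> assume "\<omega> \<in> stake (w * t) -` (stake (w * t) ` Z t) \<inter> space coin_space"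
      then obtain \<omega>' s where eq: "stake (w * t) \<omega>' = stake (w * t) \<omega>"
        and s: "exec w c (init_state n es \<omega>') t s" "Q (reg s 0)"
        by (auto simp: Z_def)
      have "init_state n es \<omega> = (init_state n es \<omega>')\<lparr>coins := \<omega>\<rparr>" "coins (init_state n es \<omega>') = \<omega>'"
        by (simp_all add: init_state_def)
      with exec_coins_prefix[OF s(1), of 0 \<omega>] eq obtain \<omega>'' where
        "exec w c (init_state n es \<omega>) t (s\<lparr>coins := \<omega>''\<rparr>)" by auto
      with s(2) show "\<omega> \<in> Z t" by (auto simp: Z_def intro!: exI[of _ "s\<lparr>coins := \<omega>''\<rparr>"])
    qed auto
    moreover have "stake (w * t) \<in> measurable coin_space (count_space UNIV)"
    proof -
      have "stake (w * t) \<in> measurable (stream_space (count_space (UNIV :: bool set))) (count_space UNIV)"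
        by measurable
      moreover have "sets (stream_space (count_space (UNIV :: bool set))) = sets coin_space"
        unfolding coin_space_def by (rule sets_stream_space_cong) simp
      ultimately show ?thesis using measurable_cong_sets by blast
    qed
    ultimately show ?thesis by (metis measurable_sets sets_UNIV UNIV_I sets_count_space Pow_UNIV)
  qed
  then have "(\<Union>t. Z t) \<in> sets coin_space" by blast
  also have "(\<Union>t. Z t) = {\<omega>. \<exists>t s. exec w c (init_state n es \<omega>) t s \<and> Q (reg s 0)}"
    by (auto simp: Z_def)
  finally show ?thesis .
qed

section \<open>Total correctness with time bounds\<close>

definition terminates_within :: "nat \<Rightarrow> com \<Rightarrow> nat \<Rightarrow> (state \<Rightarrow> bool) \<Rightarrow> state \<Rightarrow> bool" where
  "terminates_within w c T Q s \<longleftrightarrow> (\<exists>t s'. t \<le> T \<and> exec w c s t s' \<and> Q s')"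

lemma terminates_within_mono:
  "terminates_within w c T Q s \<Longrightarrow> T \<le> T' \<Longrightarrow> (\<And>s'. Q s' \<Longrightarrow> Q' s') \<Longrightarrow>
    terminates_within w c T' Q' s"
  unfolding terminates_within_def using order_trans by blast

text \<open>\<open>terminates_within\<close> takes the state last, so it acts as a weakest
  precondition: the claim about the second program is itself the postcondition of the first.\<close>

lemma terminates_within_Seq:
  assumes "terminates_within w c\<^sub>1 T\<^sub>1 (terminates_within w c\<^sub>2 T\<^sub>2 Q) s"
  shows "terminates_within w (Seq c\<^sub>1 c\<^sub>2) (T\<^sub>1 + T\<^sub>2) Q s"
  using assms unfolding terminates_within_def by (meson exec_Seq add_mono)

text \<open>Loops test only for zero, so counters run downwards and the invariant is indexed by the
  current counter value. A round costs the body plus one test; the failing last test contributes the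
  final 1.\<close>

lemma terminates_within_countdown:
  assumes body: "\<And>j s. j < N \<Longrightarrow> I (Suc j) s \<Longrightarrow> terminates_within w c T (I j) s"
    and counter: "\<And>j s. j \<le> N \<Longrightarrow> I j s \<Longrightarrow> reg s x = j"
    and "j \<le> N" "I j s"
  shows "terminates_within w (WhileNZ x c) (j * Suc T + 1) (I 0) s"
  using assms(3,4)
proof (induction j arbitrary: s)
  case 0
  then show ?case
    using counter[of 0 s] unfolding terminates_within_def
    by (intro exI[of _ 1] exI[of _ s]) (auto intro: exec_WhileF[simplified])
next
  case (Suc j)
  then obtain t s' where 1: "t \<le> T" "exec w c s t s'" "I j s'"
    using body[of j s] unfolding terminates_within_def by auto
  then obtain t' s'' where 2: "t' \<le> j * Suc T + 1" "exec w (WhileNZ x c) s' t' s''" "I 0 s''"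
    using Suc.IH[of s'] Suc.prems unfolding terminates_within_def by auto
  have "exec w (WhileNZ x c) s (Suc (t + t')) s''"
    using 1 2 counter[of "Suc j" s] Suc.prems by (intro exec_WhileT) auto
  then show ?case
    using 1 2 unfolding terminates_within_def by (intro exI[of _ "Suc (t + t')"] exI[of _ s'']) auto
qed

text \<open>The last equation is a mere default; \<open>straight\<close> singles out the commands
  whose effect \<open>step\<close> really describes.\<close>

fun step :: "nat \<Rightarrow> com \<Rightarrow> state \<Rightarrow> state" where
  "step w (Const x a) s = set_reg x (a mod 2 ^ w) s"
| "step w (Op f x y z) s = set_reg x (binop_val w f (reg s y) (reg s z)) s"
| "step w (Load x y) s = set_reg x (mem s (reg s y)) s"
| "step w c s = s"

fun straight :: "com \<Rightarrow> bool" where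
  "straight (Const x a) = True"
| "straight (Op f x y z) = True"
| "straight (Load x y) = True"
| "straight c = False"

definition block :: "com list \<Rightarrow> com" where
  "block cs = foldr Seq cs Skip"

lemma register_only_block: "list_all register_only cs \<Longrightarrow> register_only (block cs)"
  by (induction cs) (auto simp: block_def)

text \<open>A \<open>block\<close> ends in \<open>Skip\<close>, which costs a step of its own; hence
  the strict bound on \<open>length cs\<close>.\<close>

lemma terminates_within_block:
  assumes "list_all straight cs" and "Q (fold (step w) cs s)" and "length cs < T"
  shows "terminates_within w (block cs) T Q s"
proof -
  have "exec w (block cs) s (Suc (length cs)) (fold (step w) cs s)"
    using assms(1)
  proof (induction cs arbitrary: s)
    case Nil
    then show ?case using exec_Skip[of w s] by (simp add: block_def)
  next
    case (Cons c cs)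
    then have "exec w c s 1 (step w c s)"
      by (cases c) (auto intro: exec_Const[simplified] exec_Op[simplified] exec_Load[simplified])
    from exec_Seq[OF this Cons.IH] Cons.prems show ?case by (simp add: block_def)
  qed
  with assms(2,3) show ?thesis unfolding terminates_within_def by (meson Suc_leI)
qed

section \<open>Counting embeddings\<close>

text \<open>Extensional functions make this set finite and identify an embedding with its values on
  \<open>verts P\<close>. The equivalence on edges makes the image an induced copy.\<close>

definition embeddings :: "'a graph \<Rightarrow> 'b graph \<Rightarrow> ('a \<Rightarrow> 'b) set" where
  "embeddings P G = {f \<in> verts P \<rightarrow>\<^sub>E verts G. inj_on f (verts P) \<and>
     (\<forall>u\<in>verts P. \<forall>v\<in>verts P. {u, v} \<in> edges P \<longleftrightarrow> {f u, f v} \<in> edges G)}"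

lemma finite_embeddings: "finite (verts P) \<Longrightarrow> finite (verts G) \<Longrightarrow> finite (embeddings P G)"
  unfolding embeddings_def by (rule finite_subset[of _ "verts P \<rightarrow>\<^sub>E verts G"]) (auto intro: finite_PiE)

text \<open>Composition with \<open>h\<close> carries the automorphisms of \<open>P\<close>, which
  are \<open>embeddings P P\<close> because \<open>verts P\<close> is finite, bijectively to the
  embeddings with image \<open>S\<close>; composing with the inverse of \<open>h\<close> undoes
  it.\<close>

lemma card_embeddings_onto:
  assumes fin: "finite (verts P)" and h: "h \<in> embeddings P G" and S: "S = h ` verts P"
  shows "card {f \<in> embeddings P G. f ` verts P = S} = card (embeddings P P)"
proof -
  let ?V = "verts P"
  have h': "h \<in> ?V \<rightarrow>\<^sub>E verts G" "inj_on h ?V"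
    "\<And>u v. u \<in> ?V \<Longrightarrow> v \<in> ?V \<Longrightarrow> {u, v} \<in> edges P \<longleftrightarrow> {h u, h v} \<in> edges G"
    using h by (auto simp: embeddings_def)
  have onto: "g ` ?V = ?V" if "g \<in> embeddings P P" for g
    using that fin by (intro endo_inj_surj) (auto simp: embeddings_def)
  have "bij_betw (\<lambda>g. restrict (h \<circ> g) ?V) (embeddings P P) {f \<in> embeddings P G. f ` ?V = S}"
  proof (rule bij_betw_byWitness[where f' = "\<lambda>f. restrict (inv_into ?V h \<circ> f) ?V"])
    show "\<forall>g\<in>embeddings P P. restrict (inv_into ?V h \<circ> restrict (h \<circ> g) ?V) ?V = g"
    proof (intro ballI ext)
      fix g v assume g: "g \<in> embeddings P P"
      then have "g \<in> ?V \<rightarrow>\<^sub>E ?V" by (simp add: embeddings_def)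
      then have "v \<in> ?V \<Longrightarrow> g v \<in> ?V" "v \<notin> ?V \<Longrightarrow> g v = undefined" by (auto dest: PiE_mem PiE_arb)
      then show "restrict (inv_into ?V h \<circ> restrict (h \<circ> g) ?V) ?V v = g v"
        using h'(2) by (cases "v \<in> ?V") simp_all
    qed
    show "\<forall>f\<in>{f \<in> embeddings P G. f ` ?V = S}.
        restrict (h \<circ> restrict (inv_into ?V h \<circ> f) ?V) ?V = f"
    proof (intro ballI ext)
      fix f v assume f: "f \<in> {f \<in> embeddings P G. f ` ?V = S}"
      then have "f \<in> ?V \<rightarrow>\<^sub>E verts G" by (simp add: embeddings_def)
      then have "v \<in> ?V \<Longrightarrow> f v \<in> h ` ?V" "v \<notin> ?V \<Longrightarrow> f v = undefined"
        using f S by (auto dest: PiE_arb)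
      then show "restrict (h \<circ> restrict (inv_into ?V h \<circ> f) ?V) ?V v = f v"
        by (cases "v \<in> ?V") (simp_all add: f_inv_into_f)
    qed
    show "(\<lambda>g. restrict (h \<circ> g) ?V) ` embeddings P P \<subseteq> {f \<in> embeddings P G. f ` ?V = S}"
    proof (rule image_subsetI)
      fix g assume g: "g \<in> embeddings P P"
      have g': "g \<in> ?V \<rightarrow>\<^sub>E ?V" "inj_on g ?V"
        "\<And>u v. u \<in> ?V \<Longrightarrow> v \<in> ?V \<Longrightarrow> {u, v} \<in> edges P \<longleftrightarrow> {g u, g v} \<in> edges P"
        using g by (auto simp: embeddings_def)
      have "inj_on (h \<circ> g) ?V" using g'(2) h'(2) onto[OF g] by (simp add: comp_inj_on)
      then have "restrict (h \<circ> g) ?V \<in> embeddings P G"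
        using g' h' by (auto simp: embeddings_def PiE_iff inj_on_restrict_eq)
      moreover have "restrict (h \<circ> g) ?V ` ?V = S"
        using onto[OF g] S by (metis image_comp image_restrict_eq)
      ultimately show "restrict (h \<circ> g) ?V \<in> {f \<in> embeddings P G. f ` ?V = S}" by simp
    qed
    show "(\<lambda>f. restrict (inv_into ?V h \<circ> f) ?V) ` {f \<in> embeddings P G. f ` ?V = S} \<subseteq> embeddings P P"
    proof (rule image_subsetI)
      fix f assume f: "f \<in> {f \<in> embeddings P G. f ` ?V = S}"
      then have f': "inj_on f ?V" "f ` ?V = h ` ?V"
        "\<And>u v. u \<in> ?V \<Longrightarrow> v \<in> ?V \<Longrightarrow> {u, v} \<in> edges P \<longleftrightarrow> {f u, f v} \<in> edges G"
        using S by (auto simp: embeddings_def)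
      let ?g = "inv_into ?V h"
      have "inj_on (?g \<circ> f) ?V" using f' by (intro comp_inj_on) (auto intro: inj_on_inv_into)
      moreover have gf: "?g (f v) \<in> ?V" "h (?g (f v)) = f v" if "v \<in> ?V" for v
        using f'(2) that by (metis imageI inv_into_into, metis imageI f_inv_into_f)
      moreover have "{?g (f u), ?g (f v)} \<in> edges P \<longleftrightarrow> {u, v} \<in> edges P"
        if "u \<in> ?V" "v \<in> ?V" for u v
        using f'(3)[OF that] h'(3)[OF gf(1)[OF that(1)] gf(1)[OF that(2)]] gf(2) that by simp
      ultimately show "restrict (?g \<circ> f) ?V \<in> embeddings P P"
        by (auto simp: embeddings_def inj_on_restrict_eq)
    qed
  qed
  then show ?thesis by (rule bij_betw_same_card[symmetric])
qed

lemma isomorphic_induced_iff_embedding: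
  assumes "S \<subseteq> verts G"
  shows "isomorphic (induced_subgraph G S) P \<longleftrightarrow> (\<exists>h\<in>embeddings P G. h ` verts P = S)"
proof
  assume "isomorphic (induced_subgraph G S) P"
  then obtain f where f: "bij_betw f S (verts P)"
    "\<And>u v. u \<in> S \<Longrightarrow> v \<in> S \<Longrightarrow> {u, v} \<in> edges G \<longleftrightarrow> {f u, f v} \<in> edges P"
    by (auto simp: isomorphic_def induced_subgraph_def)
  let ?h = "restrict (inv_into S f) (verts P)"
  have bij: "bij_betw (inv_into S f) (verts P) S" using f(1) by (rule bij_betw_inv_into)
  have inS: "inv_into S f v \<in> S" "f (inv_into S f v) = v" if "v \<in> verts P" for v
    using that f(1) bij by (auto simp: bij_betw_def intro: f_inv_into_f)
  have "?h \<in> embeddings P G"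
    using bij inS f(2) assms by (auto simp: embeddings_def inj_on_restrict_eq bij_betw_def)
  moreover have "?h ` verts P = S" using bij by (simp add: bij_betw_def)
  ultimately show "\<exists>h\<in>embeddings P G. h ` verts P = S" by blast
next
  assume "\<exists>h\<in>embeddings P G. h ` verts P = S"
  then obtain h where h: "inj_on h (verts P)" "h ` verts P = S"
    "\<And>u v. u \<in> verts P \<Longrightarrow> v \<in> verts P \<Longrightarrow> {u, v} \<in> edges P \<longleftrightarrow> {h u, h v} \<in> edges G"
    by (auto simp: embeddings_def)
  let ?f = "inv_into (verts P) h"
  have "bij_betw ?f S (verts P)" using h by (intro bij_betw_inv_into) (simp add: bij_betw_def)
  moreover have inS: "?f u \<in> verts P" "h (?f u) = u" if "u \<in> S" for u
    using that h(2) by (auto intro: inv_into_into f_inv_into_f)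
  moreover have "{u, v} \<in> edges G \<longleftrightarrow> {?f u, ?f v} \<in> edges P" if "u \<in> S" "v \<in> S" for u v
    using h(3)[of "?f u" "?f v"] inS that by simp
  ultimately show "isomorphic (induced_subgraph G S) P"
    by (auto simp: isomorphic_def induced_subgraph_def intro!: exI[of _ ?f])
qed

text \<open>Embeddings are sorted by image: the images are exactly the induced copies of
  \<open>P\<close>, and each is hit |Aut P| times.\<close>

lemma card_embeddings_eq_c_I:
  assumes "finite (verts P)" "finite (verts G)"
  shows "card (embeddings P G) = card (embeddings P P) * c_I G P"
proof -
  let ?\<S> = "{S. S \<subseteq> verts G \<and> isomorphic (induced_subgraph G S) P}"
  have fin: "finite ?\<S>" using assms(2) by simp
  have "f ` verts P \<in> ?\<S>" if "f \<in> embeddings P G" for f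
  proof -
    have "f ` verts P \<subseteq> verts G" using that by (auto simp: embeddings_def)
    with that isomorphic_induced_iff_embedding[OF this, of P] show ?thesis by blast
  qed
  then have "embeddings P G = (\<Union>S\<in>?\<S>. {f \<in> embeddings P G. f ` verts P = S})"
    by blast
  also have "card \<dots> = (\<Sum>S\<in>?\<S>. card {f \<in> embeddings P G. f ` verts P = S})"
    using fin finite_embeddings[OF assms] by (intro card_UN_disjoint) auto
  also have "\<dots> = (\<Sum>S\<in>?\<S>. card (embeddings P P))"
  proof (rule sum.cong[OF refl])
    fix S assume "S \<in> ?\<S>"
    then obtain h where "h \<in> embeddings P G" "h ` verts P = S"
      using isomorphic_induced_iff_embedding[of S G P] by auto
    then show "card {f \<in> embeddings P G. f ` verts P = S} = card (embeddings P P)"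
      using card_embeddings_onto[OF assms(1)] by blast
  qed
  finally show ?thesis by (simp add: c_I_def)
qed

section \<open>Cliques as embeddings of a complete graph\<close>

definition complete_graph :: "'a set \<Rightarrow> 'a graph" where
  "complete_graph V = (V, {e. e \<subseteq> V \<and> card e = 2})"

lemma embeddings_complete_eq_empty_iff:
  assumes G: "simple_graph G" and V: "finite V"
  shows "embeddings (complete_graph V) G = {} \<longleftrightarrow> \<not> has_clique (card V) G"
proof -
  \<comment> \<open>The case \<open>u = v\<close> in \<open>embeddings\<close> degenerates to a
    singleton, which is never an edge of a simple graph.\<close>
  have loop: "{u} \<notin> edges G" for u using G by (force simp: simple_graph_def)
  have edge: "{u, v} \<in> edges (complete_graph V) \<longleftrightarrow> u \<noteq> v" if "u \<in> V" "v \<in> V" for u v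
    using that by (auto simp: complete_graph_def card_insert_if)
  have "has_clique (card V) G" if f: "f \<in> embeddings (complete_graph V) G" for f
  proof -
    have f': "inj_on f V" "f ` V \<subseteq> verts G"
      "\<And>u v. u \<in> V \<Longrightarrow> v \<in> V \<Longrightarrow> u \<noteq> v \<longleftrightarrow> {f u, f v} \<in> edges G"
      using f edge by (auto simp: embeddings_def complete_graph_def)
    then show ?thesis
      unfolding has_clique_def using V
      by (intro exI[of _ "f ` V"]) (auto simp: card_image)
  qed
  moreover have "embeddings (complete_graph V) G \<noteq> {}" if clique: "has_clique (card V) G"
  proof -
    obtain S where S: "S \<subseteq> verts G" "finite S" "card S = card V"
      "\<And>u v. u \<in> S \<Longrightarrow> v \<in> S \<Longrightarrow> u \<noteq> v \<Longrightarrow> {u, v} \<in> edges G"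
      using clique by (auto simp: has_clique_def)
    then obtain f where f: "bij_betw f V S"
      using finite_same_card_bij[of V S] V by auto
    then have "inj_on f V" "f ` V = S" by (auto simp: bij_betw_def)
    then have "restrict f V \<in> embeddings (complete_graph V) G"
      unfolding embeddings_def using S(1,4) edge loop
      by (auto simp: inj_on_restrict_eq complete_graph_def inj_on_eq_iff)
    then show ?thesis by blast
  qed
  ultimately show ?thesis by blast
qed

lemma card_embeddings_le:
  assumes "finite (verts P)" "finite (verts G)"
  shows "card (embeddings P G) \<le> card (verts G) ^ card (verts P)"
proof -
  have "card (embeddings P G) \<le> card (verts P \<rightarrow>\<^sub>E verts G)"
    using assms by (intro card_mono finite_PiE) (auto simp: embeddings_def)
  then show ?thesis using assms by (simp add: card_PiE)
qed

section \<open>Embeddings with one unconstrained pair\<close>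

definition matches :: "'a set set \<Rightarrow> bool \<Rightarrow> 'a \<Rightarrow> 'a \<Rightarrow> bool" where
  "matches E p u v \<longleftrightarrow> u \<noteq> v \<and> ({u, v} \<in> E \<longleftrightarrow> p)"

text \<open>Here \<open>y\<close> and \<open>z\<close> are the images of pattern vertices k and l.
  The first two inner sums count candidates for the images of i and of j, and the third removes the
  choices where these coincide; of the pair ij only distinctness is asked. Each inner sum runs over
  a single vertex, so three nested loops evaluate the whole expression.\<close>

definition open_pair_count ::
  "'b graph \<Rightarrow> bool \<Rightarrow> bool \<Rightarrow> bool \<Rightarrow> bool \<Rightarrow> bool \<Rightarrow> int" where
  "open_pair_count G pkl pik pil pjk pjl = (\<Sum>y\<in>verts G. \<Sum>z\<in>verts G.
     of_bool (matches (edges G) pkl y z) *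
     ((\<Sum>x\<in>verts G. of_bool (matches (edges G) pik x y \<and> matches (edges G) pil x z)) *
      (\<Sum>x\<in>verts G. of_bool (matches (edges G) pjk x y \<and> matches (edges G) pjl x z)) -
      (\<Sum>x\<in>verts G. of_bool ((matches (edges G) pik x y \<and> matches (edges G) pil x z) \<and>
         (matches (edges G) pjk x y \<and> matches (edges G) pjl x z)))))"

lemma matches_sym: "matches E p u v \<longleftrightarrow> matches E p v u"
  by (auto simp: matches_def insert_commute)

lemma card_distinct_pairs:
  assumes "finite A" "finite B"
  shows "int (card {(a, b). a \<in> A \<and> b \<in> B \<and> a \<noteq> b}) = int (card A) * int (card B) - int (card (A \<inter> B))"
proof -
  have "A \<times> B = {(a, b). a \<in> A \<and> b \<in> B \<and> a \<noteq> b} \<union> (\<lambda>a. (a, a)) ` (A \<inter> B)" by auto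
  moreover have "finite {(a, b). a \<in> A \<and> b \<in> B \<and> a \<noteq> b}"
    using assms by (rule_tac finite_subset[of _ "A \<times> B"]) auto
  ultimately have "card (A \<times> B) =
      card {(a, b). a \<in> A \<and> b \<in> B \<and> a \<noteq> b} + card ((\<lambda>a. (a, a)) ` (A \<inter> B))"
    using assms by (simp only:) (rule card_Un_disjoint, auto)
  then show ?thesis
    using assms by (simp add: card_cartesian_product card_image inj_on_def flip: of_nat_mult)
qed

lemma sum_of_bool_card:
  "finite V \<Longrightarrow> (\<Sum>x\<in>V. of_bool (Q x)) = int (card {x \<in> V. Q x})"
  by (simp add: of_bool_def sum.If_cases Int_def)

text \<open>Listing \<open>y\<close> and \<open>z\<close> first splits the set as a nested
  \<open>SIGMA\<close> whose fibres consist of the distinct pairs from two independently defined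
  sets.\<close>

lemma open_pair_count_eq_card:
  assumes "finite (verts G)"
  shows "open_pair_count G pkl pik pil pjk pjl =
    int (card {(y, z, a, b). y \<in> verts G \<and> z \<in> verts G \<and> a \<in> verts G \<and> b \<in> verts G \<and>
      matches (edges G) pkl y z \<and> matches (edges G) pik a y \<and> matches (edges G) pil a z \<and>
      matches (edges G) pjk b y \<and> matches (edges G) pjl b z \<and> a \<noteq> b})"
    (is "_ = int (card ?T)")
proof -
  let ?V = "verts G" and ?m = "matches (edges G)"
  define A where "A y z = {x \<in> ?V. ?m pik x y \<and> ?m pil x z}" for y z
  define B where "B y z = {x \<in> ?V. ?m pjk x y \<and> ?m pjl x z}" for y z
  define D where "D y z = (if ?m pkl y z then {(a, b). a \<in> A y z \<and> b \<in> B y z \<and> a \<noteq> b} else {})"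
    for y z
  have fin: "finite (A y z)" "finite (B y z)" for y z
    using assms by (auto simp: A_def B_def)
  have finD: "finite (D y z)" for y z
    using fin[of y z] by (auto simp: D_def intro: finite_subset[of _ "A y z \<times> B y z"])
  have "open_pair_count G pkl pik pil pjk pjl = (\<Sum>y\<in>?V. \<Sum>z\<in>?V. int (card (D y z)))"
    unfolding open_pair_count_def
  proof (intro sum.cong refl)
    fix y z
    have "{x \<in> ?V. (?m pik x y \<and> ?m pil x z) \<and> ?m pjk x y \<and> ?m pjl x z} = A y z \<inter> B y z"
      by (auto simp: A_def B_def)
    then show "of_bool (?m pkl y z) *
     ((\<Sum>x\<in>?V. of_bool (?m pik x y \<and> ?m pil x z)) * (\<Sum>x\<in>?V. of_bool (?m pjk x y \<and> ?m pjl x z)) -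
      (\<Sum>x\<in>?V. of_bool ((?m pik x y \<and> ?m pil x z) \<and> (?m pjk x y \<and> ?m pjl x z)))) = int (card (D y z))"
      using card_distinct_pairs[OF fin, of y z y z]
      unfolding sum_of_bool_card[OF assms] by (simp add: D_def flip: A_def B_def)
  qed
  also have "\<dots> = int (card (SIGMA y:?V. SIGMA z:?V. D y z))"
    using assms finD by (simp add: card_SigmaI)
  also have "(SIGMA y:?V. SIGMA z:?V. D y z) = ?T"
    by (auto simp: D_def A_def B_def split: if_splits)
  finally show ?thesis .
qed

text \<open>Since \<open>matches\<close> includes distinctness, injectivity becomes part of the
  condition on each pair; for \<open>u = v\<close> neither graph has a loop and the edge condition
  is void.\<close>

lemma embeddings_iff_matches:
  assumes "simple_graph P" "simple_graph G"
  shows "f \<in> embeddings P G \<longleftrightarrow> f \<in> verts P \<rightarrow>\<^sub>E verts G \<and>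
    (\<forall>u\<in>verts P. \<forall>v\<in>verts P. u \<noteq> v \<longrightarrow> matches (edges G) ({u, v} \<in> edges P) (f u) (f v))"
proof -
  have "{u} \<notin> edges P" "{v} \<notin> edges G" for u v
    using assms by (force simp: simple_graph_def)+
  then have "({u, v} \<in> edges P \<longleftrightarrow> {f u, f v} \<in> edges G) \<longleftrightarrow>
    (u \<noteq> v \<longrightarrow> ({u, v} \<in> edges P \<longleftrightarrow> {f u, f v} \<in> edges G))" for u v
    by (cases "u = v") auto
  then show ?thesis unfolding embeddings_def matches_def inj_on_def by blast
qed

lemma ball_four_distinct_pairs:
  assumes "distinct [i, j, k, l]" and "\<And>u v. R u v \<longleftrightarrow> R v u"
  shows "(\<forall>u\<in>{i, j, k, l}. \<forall>v\<in>{i, j, k, l}. u \<noteq> v \<longrightarrow> R u v) \<longleftrightarrow>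
    R k l \<and> R i k \<and> R i l \<and> R j k \<and> R j l \<and> R i j"
proof -
  have "R l k = R k l" "R k i = R i k" "R l i = R i l" "R k j = R j k" "R l j = R j l" "R j i = R i j"
    using assms(2) by blast+
  then show ?thesis using assms(1) by (simp add: eq_commute[of _ i]) blast
qed

text \<open>The maps in \<open>D\<close> satisfy the five constraints other than ij and separate
  \<open>i\<close> from \<open>j\<close>. Those sending \<open>{i, j}\<close> to a nonedge are the
  embeddings of \<open>P\<close>, those sending it to an edge are the embeddings of the enlarged
  graph, because the new edge leaves the other five pairs unchanged.\<close>

lemma card_embeddings_add_edge:
  assumes P: "simple_graph P" and V: "verts P = {i, j, k, l}" and dist: "distinct [i, j, k, l]"
    and ij: "{i, j} \<notin> edges P" and G: "simple_graph G"
  shows "int (card (embeddings P G)) + int (card (embeddings (verts P, insert {i, j} (edges P)) G)) =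
    open_pair_count G ({k, l} \<in> edges P) ({i, k} \<in> edges P) ({i, l} \<in> edges P)
      ({j, k} \<in> edges P) ({j, l} \<in> edges P)" (is "_ + int (card (embeddings ?P' G)) = _")
proof -
  let ?m = "\<lambda>u v. matches (edges G) ({u, v} \<in> edges P)"
  have finP: "finite (verts P)" and finG: "finite (verts G)"
    using P G by (auto simp: simple_graph_def)
  define D where "D = {f \<in> verts P \<rightarrow>\<^sub>E verts G. ?m k l (f k) (f l) \<and> ?m i k (f i) (f k) \<and>
    ?m i l (f i) (f l) \<and> ?m j k (f j) (f k) \<and> ?m j l (f j) (f l) \<and> f i \<noteq> f j}"
  have P': "simple_graph ?P'" using P V dist by (auto simp: simple_graph_def)
  have pairs: "(\<forall>u\<in>verts P. \<forall>v\<in>verts P. u \<noteq> v \<longrightarrow> matches (edges G) ({u, v} \<in> F) (f u) (f v)) \<longleftrightarrow>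
      matches (edges G) ({k, l} \<in> F) (f k) (f l) \<and> matches (edges G) ({i, k} \<in> F) (f i) (f k) \<and>
      matches (edges G) ({i, l} \<in> F) (f i) (f l) \<and> matches (edges G) ({j, k} \<in> F) (f j) (f k) \<and>
      matches (edges G) ({j, l} \<in> F) (f j) (f l) \<and> matches (edges G) ({i, j} \<in> F) (f i) (f j)"
    for F and f :: "'a \<Rightarrow> 'b"
    unfolding V
    by (rule ball_four_distinct_pairs[OF dist, where R = "\<lambda>u v. matches (edges G) ({u, v} \<in> F) (f u) (f v)"])
      (metis insert_commute matches_sym)
  have "matches (edges G) False u v \<longleftrightarrow> u \<noteq> v \<and> {u, v} \<notin> edges G"
    "matches (edges G) True u v \<longleftrightarrow> u \<noteq> v \<and> {u, v} \<in> edges G" for u v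
    by (auto simp: matches_def)
  note pair_simps = pairs this
  have emb: "embeddings P G = {f \<in> D. {f i, f j} \<notin> edges G}"
    using ij by (intro set_eqI) (simp add: embeddings_iff_matches[OF P G] pair_simps D_def; blast)
  have other: "{k, l} \<in> insert {i, j} F \<longleftrightarrow> {k, l} \<in> F" "{i, k} \<in> insert {i, j} F \<longleftrightarrow> {i, k} \<in> F"
    "{i, l} \<in> insert {i, j} F \<longleftrightarrow> {i, l} \<in> F" "{j, k} \<in> insert {i, j} F \<longleftrightarrow> {j, k} \<in> F"
    "{j, l} \<in> insert {i, j} F \<longleftrightarrow> {j, l} \<in> F" "{i, j} \<in> insert {i, j} F \<longleftrightarrow> True" for F
    using dist by (auto simp: doubleton_eq_iff)
  have emb': "embeddings ?P' G = {f \<in> D. {f i, f j} \<in> edges G}"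
    by (intro set_eqI)
      (simp only: embeddings_iff_matches[OF P' G] fst_conv snd_conv pair_simps other D_def mem_Collect_eq,
       blast)
  have "finite D" unfolding D_def
    by (rule finite_subset[of _ "verts P \<rightarrow>\<^sub>E verts G"]) (auto intro!: finite_PiE finP finG)
  moreover have "D = embeddings P G \<union> embeddings ?P' G" "embeddings P G \<inter> embeddings ?P' G = {}"
    unfolding emb emb' by auto
  ultimately have "card (embeddings P G) + card (embeddings ?P' G) = card D"
    by (metis card_Un_disjoint finite_Un)
  moreover have "card D = card {(y, z, a, b). y \<in> verts G \<and> z \<in> verts G \<and> a \<in> verts G \<and> b \<in> verts G \<and>
      ?m k l y z \<and> ?m i k a y \<and> ?m i l a z \<and> ?m j k b y \<and> ?m j l b z \<and> a \<noteq> b}" (is "_ = card ?T")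
  proof (rule bij_betw_same_card)
    \<comment> \<open>The inverse of reading off the four values; the restriction supplies
      \<open>undefined\<close> outside \<open>verts P\<close>, as extensionality demands.\<close>
    define h where "h = (\<lambda>(y :: 'b, z, a, b). \<lambda>v \<in> verts P.
      if v = k then y else if v = l then z else if v = i then a else b)"
    have h: "h (y, z, a, b) k = y" "h (y, z, a, b) l = z" "h (y, z, a, b) i = a" "h (y, z, a, b) j = b"
      for y z a b
      using dist by (auto simp: h_def V)
    have inV: "i \<in> verts P" "j \<in> verts P" "k \<in> verts P" "l \<in> verts P" by (simp_all add: V)
    show "bij_betw (\<lambda>f. (f k, f l, f i, f j)) D ?T"
    proof (rule bij_betw_byWitness[where f' = h])
      show "\<forall>f\<in>D. h (f k, f l, f i, f j) = f"
      proof (intro ballI ext)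
        fix f v assume "f \<in> D"
        then have "v \<notin> verts P \<Longrightarrow> f v = undefined" by (auto simp: D_def)
        moreover have "v \<in> verts P \<Longrightarrow> v = i \<or> v = j \<or> v = k \<or> v = l" by (simp add: V)
        moreover have "v \<notin> verts P \<Longrightarrow> h (f k, f l, f i, f j) v = undefined" by (simp add: h_def)
        ultimately show "h (f k, f l, f i, f j) v = f v" using h by metis
      qed
      show "\<forall>t\<in>?T. (h t k, h t l, h t i, h t j) = t" using h by auto
      show "(\<lambda>f. (f k, f l, f i, f j)) ` D \<subseteq> ?T"
        unfolding D_def using inV by (auto dest: PiE_mem)
      show "h ` ?T \<subseteq> D"
      proof (rule image_subsetI)
        fix t assume t: "t \<in> ?T"
        obtain y z a b where [simp]: "t = (y, z, a, b)" by (cases t)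
        have "h t \<in> verts P \<rightarrow>\<^sub>E verts G" using t by (auto simp: h_def)
        then show "h t \<in> D" unfolding D_def using t h by simp
      qed
    qed
  qed
  ultimately show ?thesis by (simp add: open_pair_count_eq_card[OF finG])
qed

section \<open>A cubic-time counting program\<close>

text \<open>Register layout relative to the base \<open>B\<close>: \<open>0\<close> accumulator, \<open>1\<close> number of vertices, \<open>2\<close> the
  constant one, \<open>3\<close> start address of the adjacency matrix, \<open>4\<close> the constant zero, \<open>5\<close> to \<open>7\<close> the
  loop counters, \<open>8\<close> to \<open>10\<close> the three inner sums, \<open>11\<close> to \<open>15\<close> scratch.\<close>

definition match_code :: "nat \<Rightarrow> bool \<Rightarrow> nat \<Rightarrow> nat \<Rightarrow> nat \<Rightarrow> com list" where
  "match_code B p t u v =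
     [Op Mul (B + 11) u (B + 1), Op Add (B + 11) (B + 11) v, Op Add (B + 11) (B + 11) (B + 3),
      Load t (B + 11)] @
     (if p then [] else [Op Equal (B + 11) u v, Op Or t t (B + 11), Op Equal t t (B + 4)])"

text \<open>The counter is decremented first, so that values \<open>n\<close> to 1 address the
  vertices \<open>n - 1\<close> to 0. Conjunctions of 0/1 flags are formed as products, which keeps
  the body free of branches.\<close>

definition inner_code :: "nat \<Rightarrow> bool \<Rightarrow> bool \<Rightarrow> bool \<Rightarrow> bool \<Rightarrow> com list" where
  "inner_code B pik pil pjk pjl =
     [Op Sub (B + 7) (B + 7) (B + 2)] @
     match_code B pik (B + 12) (B + 7) (B + 5) @ match_code B pil (B + 13) (B + 7) (B + 6) @
     match_code B pjk (B + 14) (B + 7) (B + 5) @ match_code B pjl (B + 15) (B + 7) (B + 6) @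
     [Op Mul (B + 12) (B + 12) (B + 13), Op Mul (B + 14) (B + 14) (B + 15),
      Op Add (B + 8) (B + 8) (B + 12), Op Add (B + 9) (B + 9) (B + 14),
      Op Mul (B + 12) (B + 12) (B + 14), Op Add (B + 10) (B + 10) (B + 12)]"

text \<open>The machine has no register move; adding the zero kept in \<open>B + 4\<close> copies
  \<open>n\<close> into the counter.\<close>

definition middle_code :: "nat \<Rightarrow> bool \<Rightarrow> bool \<Rightarrow> bool \<Rightarrow> bool \<Rightarrow> bool \<Rightarrow> com" where
  "middle_code B pkl pik pil pjk pjl =
     Seq (block [Op Sub (B + 6) (B + 6) (B + 2), Const (B + 8) 0, Const (B + 9) 0, Const (B + 10) 0,
       Op Add (B + 7) (B + 1) (B + 4)])
     (Seq (WhileNZ (B + 7) (block (inner_code B pik pil pjk pjl)))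
       (block (match_code B pkl (B + 12) (B + 5) (B + 6) @
         [Op Mul (B + 8) (B + 8) (B + 9), Op Sub (B + 8) (B + 8) (B + 10),
          Op Mul (B + 8) (B + 12) (B + 8), Op Add B B (B + 8)])))"

definition outer_code :: "nat \<Rightarrow> bool \<Rightarrow> bool \<Rightarrow> bool \<Rightarrow> bool \<Rightarrow> bool \<Rightarrow> com" where
  "outer_code B pkl pik pil pjk pjl =
     Seq (block [Op Sub (B + 5) (B + 5) (B + 2), Op Add (B + 6) (B + 1) (B + 4)])
       (WhileNZ (B + 6) (middle_code B pkl pik pil pjk pjl))"

definition count_code :: "nat \<Rightarrow> bool \<Rightarrow> bool \<Rightarrow> bool \<Rightarrow> bool \<Rightarrow> bool \<Rightarrow> com" where
  "count_code B pkl pik pil pjk pjl =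
     Seq (block [Op Add (B + 5) (B + 1) (B + 4)])
       (WhileNZ (B + 5) (outer_code B pkl pik pil pjk pjl))"

definition env :: "nat \<Rightarrow> nat \<Rightarrow> nat \<Rightarrow> nat set set \<Rightarrow> state \<Rightarrow> bool" where
  "env w B n E s \<longleftrightarrow> 0 < w \<and> n < 2 ^ w \<and> reg s (B + 1) = n \<and> reg s (B + 2) = 1 \<and> reg s (B + 4) = 0 \<and>
     (\<forall>u<n. \<forall>v<n. u * n + v + reg s (B + 3) < 2 ^ w \<and>
        mem s (u * n + v + reg s (B + 3)) = of_bool ({u, v} \<in> E))"

text \<open>\<open>same_below B k s s'\<close> leaves out the accumulator \<open>B\<close>.\<close>
definition same_below :: "nat \<Rightarrow> nat \<Rightarrow> state \<Rightarrow> state \<Rightarrow> bool" where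
  "same_below B k s s' \<longleftrightarrow> mem s' = mem s \<and> coins s' = coins s \<and>
     (\<forall>r. r < B + k \<and> r \<noteq> B \<longrightarrow> reg s' r = reg s r)"

lemma same_below_refl: "same_below B k s s"
  by (simp add: same_below_def)

lemma same_below_trans: "same_below B k s s' \<Longrightarrow> same_below B k s' s'' \<Longrightarrow> same_below B k s s''"
  by (simp add: same_below_def)

lemma same_below_mono: "same_below B k s s' \<Longrightarrow> k' \<le> k \<Longrightarrow> same_below B k' s s'"
  by (simp add: same_below_def)

text \<open>\<open>env\<close> speaks only of memory and of the registers \<open>B + 1\<close> to
  \<open>B + 4\<close>, which the loops never write; the bound 5 ends exactly this range.\<close>

lemma env_same_below: "env w B n E s \<Longrightarrow> same_below B 5 s s' \<Longrightarrow> env w B n E s'"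
  by (simp add: env_def same_below_def)

lemma set_reg_simps [simp]:
  "reg (set_reg x a s) = (reg s)(x := a)" "mem (set_reg x a s) = mem s"
  by (simp_all add: set_reg_def)

lemma straight_match_code: "list_all straight (match_code B p t u v)"
  by (simp add: match_code_def)

text \<open>For a required edge the matrix entry suffices, since the diagonal is zero in a graph
  without loops. For a required nonedge equal vertices must be rejected too: the entry is joined by
  \<open>Or\<close> with the equality bit, and comparison with zero negates the result.\<close>

lemma match_code_effect:
  assumes env: "env w B n E s" and E: "graph_on n E" and "reg s u < n" "reg s v < n"
    and t: "B + 11 < t" and uv: "u < B + 11" "v < B + 11"
  obtains s' where "fold (step w) (match_code B p t u v) s = s'"
    and "reg s' t = of_bool (matches E p (reg s u) (reg s v))"
    and "mem s' = mem s" "coins s' = coins s"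
    and "\<And>r. r \<noteq> t \<Longrightarrow> r \<noteq> B + 11 \<Longrightarrow> reg s' r = reg s r"
proof -
  let ?s = "fold (step w) (match_code B p t u v) s"
  let ?u = "reg s u" and ?v = "reg s v"
  have bound: "?u * n + ?v + reg s (B + 3) < 2 ^ w"
    and val: "mem s (?u * n + ?v + reg s (B + 3)) = of_bool ({?u, ?v} \<in> E)"
    using env assms(3,4) by (auto simp: env_def)
  have mods: "(?u * n) mod 2 ^ w = ?u * n" "(?u * n + ?v) mod 2 ^ w = ?u * n + ?v"
    "(?u * n + ?v + reg s (B + 3)) mod 2 ^ w = ?u * n + ?v + reg s (B + 3)"
    using bound by auto
  have one: "1 mod 2 ^ w = (1 :: nat)" "Suc 0 mod 2 ^ w = Suc 0" using env by (simp_all add: env_def)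
  have loop: "{x} \<notin> E" for x using E by (force simp: graph_on_def simple_graph_def)
  have regs: "reg s (Suc B) = n" "reg s (B + 4) = 0"
    using env by (auto simp: env_def)
  have val': "reg ?s t = of_bool (matches E p ?u ?v)"
    using t uv regs mods val one loop
    by (cases "?u = ?v"; cases "{?u, ?v} \<in> E") (auto simp: match_code_def matches_def)
  have "mem ?s = mem s" "coins ?s = coins s"
    "\<And>r. r \<noteq> t \<Longrightarrow> r \<noteq> B + 11 \<Longrightarrow> reg ?s r = reg s r"
    by (cases p; simp add: match_code_def del: binop_val.simps)+
  with val' show ?thesis by (intro that[of ?s]) auto
qed

text \<open>\<open>Sub\<close> adds \<open>2 ^ w\<close> before a truncated natural subtraction;
  \<open>b < 2 ^ w\<close> prevents truncation, and over the integers only subtraction modulo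
  \<open>2 ^ w\<close> is left.\<close>

lemma binop_val_Sub_int:
  "b < 2 ^ w \<Longrightarrow> int (binop_val w Sub a b) = (int a - int b) mod 2 ^ w"
  using mod_add_self2[of "int a - int b" "2 ^ w"] by (simp add: of_nat_mod of_nat_diff algebra_simps)

lemma countdown_Sub: "Suc j < 2 ^ w \<Longrightarrow> binop_val w Sub (Suc j) 1 = j"
  by simp

lemma inner_code_effect:
  fixes pik pil pjk pjl :: bool
  assumes env: "env w B n E s" and E: "graph_on n E"
    and x: "reg s (B + 7) = Suc x" "x < n" and yz: "reg s (B + 5) = y" "reg s (B + 6) = z" "y < n" "z < n"
  defines "a \<equiv> of_bool (matches E pik x y \<and> matches E pil x z)"
    and "b \<equiv> of_bool (matches E pjk x y \<and> matches E pjl x z)"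
  shows "terminates_within w (block (inner_code B pik pil pjk pjl)) 36
    (\<lambda>s'. same_below B 7 s s' \<and> reg s' B = reg s B \<and> reg s' (B + 7) = x \<and>
      reg s' (B + 8) = (reg s (B + 8) + a) mod 2 ^ w \<and>
      reg s' (B + 9) = (reg s (B + 9) + b) mod 2 ^ w \<and>
      reg s' (B + 10) = (reg s (B + 10) + a * b) mod 2 ^ w) s"
proof (rule terminates_within_block)
  show "list_all straight (inner_code B pik pil pjk pjl)"
    by (simp add: inner_code_def straight_match_code)
  \<comment> \<open>The longest case has four nonedges: 1 + 4 * 7 + 6 = 35 commands.\<close>
  show "length (inner_code B pik pil pjk pjl) < 36"
    by (simp add: inner_code_def match_code_def)
  have regs: "reg s (B + 2) = 1" "n < 2 ^ w" "0 < w" using env by (auto simp: env_def)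
  have one: "Suc 0 mod 2 ^ w = Suc 0" using regs by simp
  define s0 where "s0 = step w (Op Sub (B + 7) (B + 7) (B + 2)) s"
  have "binop_val w Sub (Suc x) 1 = x" using countdown_Sub[of x w] x regs by linarith
  then have s0: "reg s0 = (reg s)(B + 7 := x)" "mem s0 = mem s" "coins s0 = coins s"
    using x regs by (simp_all add: s0_def del: binop_val.simps)
  have e0: "env w B n E s0" using env by (simp add: env_def s0)
  obtain s1 where s1: "fold (step w) (match_code B pik (B + 12) (B + 7) (B + 5)) s0 = s1"
    "reg s1 (B + 12) = of_bool (matches E pik x y)" "mem s1 = mem s0" "coins s1 = coins s0"
    "\<And>r. r \<noteq> B + 12 \<Longrightarrow> r \<noteq> B + 11 \<Longrightarrow> reg s1 r = reg s0 r"
    by (rule match_code_effect[OF e0 E, of "B + 7" "B + 5" "B + 12" pik]) (use s0 x yz in auto)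
  have e1: "env w B n E s1" using e0 by (simp add: env_def s1(3-5))
  obtain s2 where s2: "fold (step w) (match_code B pil (B + 13) (B + 7) (B + 6)) s1 = s2"
    "reg s2 (B + 13) = of_bool (matches E pil x z)" "mem s2 = mem s1" "coins s2 = coins s1"
    "\<And>r. r \<noteq> B + 13 \<Longrightarrow> r \<noteq> B + 11 \<Longrightarrow> reg s2 r = reg s1 r"
    by (rule match_code_effect[OF e1 E, of "B + 7" "B + 6" "B + 13" pil]) (use s0 s1(5) x yz in auto)
  have e2: "env w B n E s2" using e1 by (simp add: env_def s2(3-5))
  obtain s3 where s3: "fold (step w) (match_code B pjk (B + 14) (B + 7) (B + 5)) s2 = s3"
    "reg s3 (B + 14) = of_bool (matches E pjk x y)" "mem s3 = mem s2" "coins s3 = coins s2"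
    "\<And>r. r \<noteq> B + 14 \<Longrightarrow> r \<noteq> B + 11 \<Longrightarrow> reg s3 r = reg s2 r"
    by (rule match_code_effect[OF e2 E, of "B + 7" "B + 5" "B + 14" pjk]) (use s0 s1(5) s2(5) x yz in auto)
  have e3: "env w B n E s3" using e2 by (simp add: env_def s3(3-5))
  obtain s4 where s4: "fold (step w) (match_code B pjl (B + 15) (B + 7) (B + 6)) s3 = s4"
    "reg s4 (B + 15) = of_bool (matches E pjl x z)" "mem s4 = mem s3" "coins s4 = coins s3"
    "\<And>r. r \<noteq> B + 15 \<Longrightarrow> r \<noteq> B + 11 \<Longrightarrow> reg s4 r = reg s3 r"
    by (rule match_code_effect[OF e3 E, of "B + 7" "B + 6" "B + 15" pjl])
      (use s0 s1(5) s2(5) s3(5) x yz in auto)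
  have fold_eq: "fold (step w) (inner_code B pik pil pjk pjl) s =
    fold (step w) [Op Mul (B + 12) (B + 12) (B + 13), Op Mul (B + 14) (B + 14) (B + 15),
      Op Add (B + 8) (B + 8) (B + 12), Op Add (B + 9) (B + 9) (B + 14),
      Op Mul (B + 12) (B + 12) (B + 14), Op Add (B + 10) (B + 10) (B + 12)] s4"
    unfolding inner_code_def fold_append comp_apply s0_def[symmetric]
    by (simp only: fold_simps s0_def[symmetric] s1(1) s2(1) s3(1) s4(1))
  have r4: "reg s4 (B + 12) = of_bool (matches E pik x y)" "reg s4 (B + 13) = of_bool (matches E pil x z)"
    "reg s4 (B + 14) = of_bool (matches E pjk x y)" "reg s4 (B + 15) = of_bool (matches E pjl x z)"
    "\<And>r. r < B + 11 \<Longrightarrow> reg s4 r = ((reg s)(B + 7 := x)) r" "mem s4 = mem s" "coins s4 = coins s"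
    using s0 s1 s2 s3 s4 by simp_all
  show "same_below B 7 s (fold (step w) (inner_code B pik pil pjk pjl) s) \<and>
    reg (fold (step w) (inner_code B pik pil pjk pjl) s) B = reg s B \<and>
    reg (fold (step w) (inner_code B pik pil pjk pjl) s) (B + 7) = x \<and>
    reg (fold (step w) (inner_code B pik pil pjk pjl) s) (B + 8) = (reg s (B + 8) + a) mod 2 ^ w \<and>
    reg (fold (step w) (inner_code B pik pil pjk pjl) s) (B + 9) = (reg s (B + 9) + b) mod 2 ^ w \<and>
    reg (fold (step w) (inner_code B pik pil pjk pjl) s) (B + 10) = (reg s (B + 10) + a * b) mod 2 ^ w"
    unfolding fold_eq by (auto simp: r4 same_below_def a_def b_def one)
qed

lemma sum_countdown:
  fixes f :: "nat \<Rightarrow> 'a :: comm_monoid_add"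
  shows "j < n \<Longrightarrow> (\<Sum>x\<in>{j..<n}. f x) = (\<Sum>x\<in>{Suc j..<n}. f x) + f j"
  by (simp add: sum.atLeast_Suc_lessThan add.commute)

lemma inner_loop_effect:
  fixes pik pil pjk pjl :: bool
  assumes env: "env w B n E s" and E: "graph_on n E"
    and yz: "reg s (B + 5) = y" "reg s (B + 6) = z" "y < n" "z < n"
    and init: "reg s (B + 7) = n" "reg s (B + 8) = 0" "reg s (B + 9) = 0" "reg s (B + 10) = 0"
  defines "a \<equiv> \<lambda>x. of_bool (matches E pik x y \<and> matches E pil x z)"
    and "b \<equiv> \<lambda>x. of_bool (matches E pjk x y \<and> matches E pjl x z)"
  shows "terminates_within w (WhileNZ (B + 7) (block (inner_code B pik pil pjk pjl))) (n * 37 + 1)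
    (\<lambda>s'. same_below B 7 s s' \<and> reg s' B = reg s B \<and>
      reg s' (B + 8) = (\<Sum>x<n. a x) mod 2 ^ w \<and>
      reg s' (B + 9) = (\<Sum>x<n. b x) mod 2 ^ w \<and>
      reg s' (B + 10) = (\<Sum>x<n. a x * b x) mod 2 ^ w) s"
proof -
  \<comment> \<open>With the counter at \<open>j\<close>, exactly the vertices from \<open>j\<close>
    to \<open>n - 1\<close> have been counted.\<close>
  define I where "I j s' \<longleftrightarrow> same_below B 7 s s' \<and> reg s' B = reg s B \<and> reg s' (B + 7) = j \<and>
      reg s' (B + 8) = (\<Sum>x\<in>{j..<n}. a x) mod 2 ^ w \<and>
      reg s' (B + 9) = (\<Sum>x\<in>{j..<n}. b x) mod 2 ^ w \<and>
      reg s' (B + 10) = (\<Sum>x\<in>{j..<n}. a x * b x) mod 2 ^ w" for j s'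
  have "terminates_within w (WhileNZ (B + 7) (block (inner_code B pik pil pjk pjl)))
      (n * Suc 36 + 1) (I 0) s"
  proof (rule terminates_within_countdown[where N = n])
    fix j s' assume j: "j < n" and I: "I (Suc j) s'"
    have "env w B n E s'" using env_same_below[OF env] I same_below_mono[of B 7] by (auto simp: I_def)
    moreover have "reg s' (B + 7) = Suc j" "reg s' (B + 5) = y" "reg s' (B + 6) = z"
      using I yz by (simp_all add: I_def same_below_def)
    ultimately have "terminates_within w (block (inner_code B pik pil pjk pjl)) 36
      (\<lambda>s''. same_below B 7 s' s'' \<and> reg s'' B = reg s' B \<and> reg s'' (B + 7) = j \<and>
        reg s'' (B + 8) = (reg s' (B + 8) + a j) mod 2 ^ w \<and>
        reg s'' (B + 9) = (reg s' (B + 9) + b j) mod 2 ^ w \<and>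
        reg s'' (B + 10) = (reg s' (B + 10) + a j * b j) mod 2 ^ w) s'"
      unfolding a_def b_def using j yz by (intro inner_code_effect[OF _ E]) auto
    then show "terminates_within w (block (inner_code B pik pil pjk pjl)) 36 (I j) s'"
      by (rule terminates_within_mono[OF _ order_refl])
        (use I j in \<open>auto simp: I_def same_below_def sum_countdown mod_simps\<close>)
  qed (auto simp: I_def init same_below_refl)
  then show ?thesis
    by (rule terminates_within_mono) (auto simp: I_def atLeast0LessThan)
qed


definition open_pair_term :: "nat \<Rightarrow> nat set set \<Rightarrow> bool \<Rightarrow> bool \<Rightarrow> bool \<Rightarrow> bool \<Rightarrow> bool \<Rightarrow> nat \<Rightarrow> nat \<Rightarrow> int" where
  "open_pair_term n E pkl pik pil pjk pjl y z = of_bool (matches E pkl y z) *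
     ((\<Sum>x<n. of_bool (matches E pik x y \<and> matches E pil x z)) *
      (\<Sum>x<n. of_bool (matches E pjk x y \<and> matches E pjl x z)) -
      (\<Sum>x<n. of_bool ((matches E pik x y \<and> matches E pil x z) \<and>
         (matches E pjk x y \<and> matches E pjl x z))))"

lemma open_pair_count_eq_sum_term:
  "open_pair_count ({..<n}, E) pkl pik pil pjk pjl =
     (\<Sum>y<n. \<Sum>z<n. open_pair_term n E pkl pik pil pjk pjl y z)"
  by (simp add: open_pair_count_def open_pair_term_def)

text \<open>The time splits into 6 for the initialisation, \<open>n * 37 + 1\<close> for the inner
  loop and 12 for the closing block.\<close>

lemma middle_code_effect:
  assumes env: "env w B n E s" and E: "graph_on n E"
    and yz: "reg s (B + 5) = y" "reg s (B + 6) = Suc z" "y < n" "z < n"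
  shows "terminates_within w (middle_code B pkl pik pil pjk pjl) (n * 37 + 19)
    (\<lambda>s'. same_below B 6 s s' \<and> reg s' (B + 6) = z \<and> reg s' B < 2 ^ w \<and>
      int (reg s' B) = (int (reg s B) + open_pair_term n E pkl pik pil pjk pjl y z) mod 2 ^ w) s"
proof -
  define a where "a x = (of_bool (matches E pik x y \<and> matches E pil x z) :: nat)" for x
  define b where "b x = (of_bool (matches E pjk x y \<and> matches E pjl x z) :: nat)" for x
  let ?init = "[Op Sub (B + 6) (B + 6) (B + 2), Const (B + 8) 0, Const (B + 9) 0, Const (B + 10) 0,
       Op Add (B + 7) (B + 1) (B + 4)]"
  let ?fin = "[Op Mul (B + 8) (B + 8) (B + 9), Op Sub (B + 8) (B + 8) (B + 10),
          Op Mul (B + 8) (B + 12) (B + 8), Op Add B B (B + 8)]"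
  let ?post = "\<lambda>s'. same_below B 6 s s' \<and> reg s' (B + 6) = z \<and> reg s' B < 2 ^ w \<and>
      int (reg s' B) = (int (reg s B) + open_pair_term n E pkl pik pil pjk pjl y z) mod 2 ^ w"
  have regs: "reg s (B + 2) = 1" "reg s (Suc B) = n" "reg s (B + 4) = 0" "n < 2 ^ w" "0 < w"
    using env by (auto simp: env_def)
  have subz: "binop_val w Sub (Suc z) 1 = z" using countdown_Sub[of z w] yz regs by linarith
  define s1 where "s1 = fold (step w) ?init s"
  have s1: "reg s1 = (reg s)(B + 6 := z, B + 8 := 0, B + 9 := 0, B + 10 := 0, B + 7 := n)"
    "mem s1 = mem s" "coins s1 = coins s"
    using regs subz yz by (simp_all add: s1_def del: binop_val.simps(2))
  have e1: "env w B n E s1" using env by (simp add: env_def s1)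
  have fin: "terminates_within w (block (match_code B pkl (B + 12) (B + 5) (B + 6) @ ?fin)) 12 ?post s2"
    if s2: "same_below B 7 s1 s2" "reg s2 B = reg s1 B"
      "reg s2 (B + 8) = (\<Sum>x<n. a x) mod 2 ^ w" "reg s2 (B + 9) = (\<Sum>x<n. b x) mod 2 ^ w"
      "reg s2 (B + 10) = (\<Sum>x<n. a x * b x) mod 2 ^ w" for s2
  proof (rule terminates_within_block)
    have e2: "env w B n E s2" using env_same_below[OF e1] s2(1) same_below_mono[of B 7] by simp
    have r2: "reg s2 (B + 5) = y" "reg s2 (B + 6) = z" "reg s2 B = reg s B"
      using s2(1,2) yz by (simp_all add: same_below_def s1)
    obtain s3 where s3: "fold (step w) (match_code B pkl (B + 12) (B + 5) (B + 6)) s2 = s3"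
      "reg s3 (B + 12) = of_bool (matches E pkl y z)" "mem s3 = mem s2" "coins s3 = coins s2"
      "\<And>r. r \<noteq> B + 12 \<Longrightarrow> r \<noteq> B + 11 \<Longrightarrow> reg s3 r = reg s2 r"
      by (rule match_code_effect[OF e2 E, of "B + 5" "B + 6" "B + 12" pkl]) (use r2 yz in auto)
    define s4 where "s4 = fold (step w) ?fin s3"
    let ?d = "binop_val w Sub (((\<Sum>x<n. a x) * (\<Sum>x<n. b x)) mod 2 ^ w) ((\<Sum>x<n. a x * b x) mod 2 ^ w)"
    have s4: "reg s4 B = (reg s B + of_bool (matches E pkl y z) * ?d) mod 2 ^ w"
      "mem s4 = mem s3" "coins s4 = coins s3" "\<And>r. r \<noteq> B \<Longrightarrow> r \<noteq> B + 8 \<Longrightarrow> reg s4 r = reg s3 r"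
      using s3(2) s3(5)[of B] s3(5)[of "B + 8"] s3(5)[of "B + 9"] s3(5)[of "B + 10"] s2(3-5) r2(3)
      by (simp_all add: s4_def mod_simps del: binop_val.simps(2))
    have "int ?d = (int (\<Sum>x<n. a x) * int (\<Sum>x<n. b x) - int (\<Sum>x<n. a x * b x)) mod 2 ^ w"
      by (subst binop_val_Sub_int) (simp_all add: of_nat_mod mod_simps del: of_nat_sum)
    then have "int (reg s4 B) = (int (reg s B) + of_bool (matches E pkl y z) *
        (int (\<Sum>x<n. a x) * int (\<Sum>x<n. b x) - int (\<Sum>x<n. a x * b x))) mod 2 ^ w"
      by (simp add: s4(1) of_nat_mod mod_simps del: of_nat_sum binop_val.simps)
    also have "of_bool (matches E pkl y z) *
        (int (\<Sum>x<n. a x) * int (\<Sum>x<n. b x) - int (\<Sum>x<n. a x * b x)) =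
        open_pair_term n E pkl pik pil pjk pjl y z"
      by (simp only: open_pair_term_def a_def b_def of_nat_sum of_nat_of_bool flip: of_bool_conj)
    finally have "int (reg s4 B) = (int (reg s B) + open_pair_term n E pkl pik pil pjk pjl y z) mod 2 ^ w" .
    moreover have "reg s4 B < 2 ^ w" by (simp add: s4(1))
    moreover have "same_below B 6 s s4" "reg s4 (B + 6) = z"
      using s2(1) r2 by (simp_all add: same_below_def s4 s3 s1)
    moreover have "fold (step w) (match_code B pkl (B + 12) (B + 5) (B + 6) @ ?fin) s2 = s4"
      by (simp only: fold_append comp_apply s3(1) s4_def)
    ultimately show "?post (fold (step w) (match_code B pkl (B + 12) (B + 5) (B + 6) @ ?fin) s2)"
      by simp
  qed (simp_all add: straight_match_code, simp add: match_code_def)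
  have "terminates_within w (WhileNZ (B + 7) (block (inner_code B pik pil pjk pjl))) (n * 37 + 1)
    (\<lambda>s2. same_below B 7 s1 s2 \<and> reg s2 B = reg s1 B \<and>
      reg s2 (B + 8) = (\<Sum>x<n. a x) mod 2 ^ w \<and> reg s2 (B + 9) = (\<Sum>x<n. b x) mod 2 ^ w \<and>
      reg s2 (B + 10) = (\<Sum>x<n. a x * b x) mod 2 ^ w) s1"
    unfolding a_def b_def by (intro inner_loop_effect[OF e1 E]) (use yz in \<open>auto simp: s1\<close>)
  then have "terminates_within w (WhileNZ (B + 7) (block (inner_code B pik pil pjk pjl))) (n * 37 + 1)
    (terminates_within w (block (match_code B pkl (B + 12) (B + 5) (B + 6) @ ?fin)) 12 ?post) s1"
    by (rule terminates_within_mono) (simp_all only: fin order_refl)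
  then have "terminates_within w (Seq (WhileNZ (B + 7) (block (inner_code B pik pil pjk pjl)))
    (block (match_code B pkl (B + 12) (B + 5) (B + 6) @ ?fin))) (n * 37 + 1 + 12) ?post s1"
    by (rule terminates_within_Seq)
  then have "terminates_within w (block ?init) 6 (terminates_within w
    (Seq (WhileNZ (B + 7) (block (inner_code B pik pil pjk pjl)))
    (block (match_code B pkl (B + 12) (B + 5) (B + 6) @ ?fin))) (n * 37 + 1 + 12) ?post) s"
    by (intro terminates_within_block) (simp_all only: s1_def, simp_all)
  from terminates_within_Seq[OF this] show ?thesis
    unfolding middle_code_def by (rule terminates_within_mono) auto
qed

lemma outer_code_effect:
  assumes env: "env w B n E s" and E: "graph_on n E"
    and y: "reg s (B + 5) = Suc y" "y < n" and acc: "reg s B < 2 ^ w"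
  shows "terminates_within w (outer_code B pkl pik pil pjk pjl) (n * (n * 37 + 20) + 4)
    (\<lambda>s'. same_below B 5 s s' \<and> reg s' (B + 5) = y \<and> reg s' B < 2 ^ w \<and>
      int (reg s' B) = (int (reg s B) + (\<Sum>z<n. open_pair_term n E pkl pik pil pjk pjl y z)) mod 2 ^ w) s"
proof -
  let ?f = "open_pair_term n E pkl pik pil pjk pjl y"
  let ?init = "[Op Sub (B + 5) (B + 5) (B + 2), Op Add (B + 6) (B + 1) (B + 4)]"
  have regs: "reg s (B + 2) = 1" "reg s (Suc B) = n" "reg s (B + 4) = 0" "n < 2 ^ w" "0 < w"
    using env by (auto simp: env_def)
  have suby: "binop_val w Sub (Suc y) 1 = y" using countdown_Sub[of y w] y regs by linarith
  define s1 where "s1 = fold (step w) ?init s"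
  have s1: "reg s1 = (reg s)(B + 5 := y, B + 6 := n)" "mem s1 = mem s" "coins s1 = coins s"
    using regs suby y by (simp_all add: s1_def del: binop_val.simps(2))
  define I where "I j s' \<longleftrightarrow> same_below B 6 s1 s' \<and> reg s' (B + 6) = j \<and> reg s' B < 2 ^ w \<and>
    int (reg s' B) = (int (reg s B) + (\<Sum>z\<in>{j..<n}. ?f z)) mod 2 ^ w" for j s'
  have e1: "env w B n E s1" using env by (simp add: env_def s1)
  have "terminates_within w (WhileNZ (B + 6) (middle_code B pkl pik pil pjk pjl))
      (n * Suc (n * 37 + 19) + 1) (I 0) s1"
  proof (rule terminates_within_countdown[where N = n])
    fix j s' assume j: "j < n" and I: "I (Suc j) s'"
    have "env w B n E s'" using env_same_below[OF e1] I same_below_mono[of B 6] by (auto simp: I_def)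
    moreover have "reg s' (B + 5) = y" "reg s' (B + 6) = Suc j"
      using I by (simp_all add: I_def same_below_def s1)
    ultimately have "terminates_within w (middle_code B pkl pik pil pjk pjl) (n * 37 + 19)
      (\<lambda>s''. same_below B 6 s' s'' \<and> reg s'' (B + 6) = j \<and> reg s'' B < 2 ^ w \<and>
        int (reg s'' B) = (int (reg s' B) + ?f j) mod 2 ^ w) s'"
      using j y by (intro middle_code_effect[OF _ E])
    then show "terminates_within w (middle_code B pkl pik pil pjk pjl) (n * 37 + 19) (I j) s'"
      by (rule terminates_within_mono[OF _ order_refl])
        (use I j in \<open>auto simp: I_def sum_countdown mod_simps add.assoc elim: same_below_trans\<close>)
  \<comment> \<open>Before the first round the sum is empty and the invariant says that the
    accumulator equals its own residue, which is what \<open>acc\<close> provides.\<close>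
  qed (use acc in \<open>auto simp: I_def s1 same_below_refl\<close>)
  moreover have "I 0 s' \<Longrightarrow> same_below B 5 s s' \<and> reg s' (B + 5) = y \<and> reg s' B < 2 ^ w \<and>
      int (reg s' B) = (int (reg s B) + (\<Sum>z<n. ?f z)) mod 2 ^ w" for s'
    by (simp add: I_def same_below_def s1 atLeast0LessThan)
  ultimately have "terminates_within w (block ?init) 3 (terminates_within w
      (WhileNZ (B + 6) (middle_code B pkl pik pil pjk pjl)) (n * Suc (n * 37 + 19) + 1)
      (\<lambda>s'. same_below B 5 s s' \<and> reg s' (B + 5) = y \<and> reg s' B < 2 ^ w \<and>
      int (reg s' B) = (int (reg s B) + (\<Sum>z<n. ?f z)) mod 2 ^ w)) s"
    by (intro terminates_within_block)
      (simp_all only: s1_def, auto elim: terminates_within_mono)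
  from terminates_within_Seq[OF this] show ?thesis
    unfolding outer_code_def by (rule terminates_within_mono) auto
qed

lemma count_code_effect:
  assumes env: "env w B n E s" and E: "graph_on n E" and acc: "reg s B < 2 ^ w" and n: "1 \<le> n"
  shows "terminates_within w (count_code B pkl pik pil pjk pjl) (70 * n ^ 3)
    (\<lambda>s'. same_below B 5 s s' \<and> reg s' B < 2 ^ w \<and>
      int (reg s' B) = (int (reg s B) + open_pair_count ({..<n}, E) pkl pik pil pjk pjl) mod 2 ^ w) s"
proof -
  let ?f = "\<lambda>y. \<Sum>z<n. open_pair_term n E pkl pik pil pjk pjl y z"
  let ?init = "[Op Add (B + 5) (B + 1) (B + 4)]"
  let ?post = "\<lambda>s'. same_below B 5 s s' \<and> reg s' B < 2 ^ w \<and>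
      int (reg s' B) = (int (reg s B) + open_pair_count ({..<n}, E) pkl pik pil pjk pjl) mod 2 ^ w"
  have regs: "reg s (Suc B) = n" "reg s (B + 4) = 0" "n < 2 ^ w" "0 < w"
    using env by (auto simp: env_def)
  define s1 where "s1 = fold (step w) ?init s"
  have s1: "reg s1 = (reg s)(B + 5 := n)" "mem s1 = mem s" "coins s1 = coins s"
    using regs by (simp_all add: s1_def)
  define I where "I j s' \<longleftrightarrow> same_below B 5 s1 s' \<and> reg s' (B + 5) = j \<and> reg s' B < 2 ^ w \<and>
    int (reg s' B) = (int (reg s B) + (\<Sum>y\<in>{j..<n}. ?f y)) mod 2 ^ w" for j s'
  have e1: "env w B n E s1" using env by (simp add: env_def s1)
  have "terminates_within w (WhileNZ (B + 5) (outer_code B pkl pik pil pjk pjl))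
      (n * Suc (n * (n * 37 + 20) + 4) + 1) (I 0) s1"
  proof (rule terminates_within_countdown[where N = n])
    fix j s' assume j: "j < n" and I: "I (Suc j) s'"
    have "env w B n E s'" using env_same_below[OF e1] I by (auto simp: I_def)
    then have "terminates_within w (outer_code B pkl pik pil pjk pjl) (n * (n * 37 + 20) + 4)
      (\<lambda>s''. same_below B 5 s' s'' \<and> reg s'' (B + 5) = j \<and> reg s'' B < 2 ^ w \<and>
        int (reg s'' B) = (int (reg s' B) + ?f j) mod 2 ^ w) s'"
      using I j by (intro outer_code_effect[OF _ E]) (auto simp: I_def)
    then show "terminates_within w (outer_code B pkl pik pil pjk pjl) (n * (n * 37 + 20) + 4) (I j) s'"
      by (rule terminates_within_mono[OF _ order_refl])
        (use I j in \<open>auto simp: I_def sum_countdown[of j n ?f] mod_simps add.assoc elim: same_below_trans\<close>)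
  qed (use acc in \<open>auto simp: I_def s1 same_below_refl\<close>)
  moreover have "I 0 s' \<Longrightarrow> ?post s'" for s'
    by (simp add: I_def same_below_def s1 atLeast0LessThan open_pair_count_eq_sum_term)
  ultimately have "terminates_within w (block ?init) 2 (terminates_within w
      (WhileNZ (B + 5) (outer_code B pkl pik pil pjk pjl)) (n * Suc (n * (n * 37 + 20) + 4) + 1) ?post) s"
    by (intro terminates_within_block)
      (simp_all only: s1_def, auto elim: terminates_within_mono)
  from terminates_within_Seq[OF this] show ?thesis
    unfolding count_code_def
  proof (rule terminates_within_mono)
    \<comment> \<open>The cost is 37 n^3 + 20 n^2 + 5 n + 3. As \<open>n\<close> is positive, all
      lower powers are at most \<open>n ^ 3\<close>; this gives 65, rounded up to 70.\<close>
    have "n \<le> n ^ 3" "n ^ 2 \<le> n ^ 3" "1 \<le> n ^ 3"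
      using n power_increasing[of 1 3 n] power_increasing[of 2 3 n] by auto
    then have "37 * n ^ 3 + 20 * n ^ 2 + 5 * n + 3 \<le> 70 * n ^ 3" by linarith
    then show "2 + (n * Suc (n * (n * 37 + 20) + 4) + 1) \<le> 70 * n ^ 3"
      by (simp add: algebra_simps power2_eq_square power3_eq_cube)
  qed
qed

lemma register_only_count_code: "register_only (count_code B pkl pik pil pjk pjl)"
  by (simp add: count_code_def outer_code_def middle_code_def inner_code_def match_code_def
      register_only_block)

text \<open>The accumulator receives the correction term, the part of the embedding count obtainable
  in cubic time. Subtracting it from the true count of embeddings of \<open>P\<close> leaves
  \<open>\<sigma>\<close> times that of the clique.\<close>

definition computes_embeddings_upto_cliques ::
  "nat \<Rightarrow> 'a graph \<Rightarrow> int \<Rightarrow> com \<Rightarrow> nat \<Rightarrow> bool" where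
  "computes_embeddings_upto_cliques B P \<sigma> c K \<longleftrightarrow>
    (\<forall>w n E s. env w B n E s \<longrightarrow> graph_on n E \<longrightarrow> 1 \<le> n \<longrightarrow> reg s B = 0 \<longrightarrow>
      terminates_within w c (K * n ^ 3) (\<lambda>s'. same_below B 5 s s' \<and> reg s' B < 2 ^ w \<and>
        int (reg s' B) = (int (card (embeddings P ({..<n}, E))) -
          \<sigma> * int (card (embeddings (complete_graph (verts P)) ({..<n}, E)))) mod 2 ^ w) s)"

text \<open>Induction on the number of missing edges. If X is the correction term after adding one
  edge and D the count with that pair released, then D - X is the correction term before, with the
  opposite sign \<open>\<sigma>\<close>. The vertex set, and with it the clique, stays fixed
  throughout.\<close>

lemma embeddings_code_exists:
  fixes P :: "'a graph"
  assumes "simple_graph P" and "card (verts P) = 4"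
  shows "\<exists>c K \<sigma>. register_only c \<and> \<sigma> \<in> {1, - 1} \<and> computes_embeddings_upto_cliques B P \<sigma> c K"
  using assms
proof (induction "card ({e. e \<subseteq> verts P \<and> card e = 2} - edges P)" arbitrary: P rule: less_induct)
  case less
  let ?V = "verts P" and ?K4 = "complete_graph (verts P)"
  have finV: "finite ?V" using less.prems by (simp add: simple_graph_def)
  have sub: "edges P \<subseteq> {e. e \<subseteq> ?V \<and> card e = 2}" using less.prems by (auto simp: simple_graph_def)
  show ?case
  proof (cases "edges P = {e. e \<subseteq> ?V \<and> card e = 2}")
    case True
    then have P: "P = ?K4" by (simp add: complete_graph_def prod_eq_iff)
    \<comment> \<open>For the complete graph the correction term is 0, the initial accumulator, and
      the single step of \<open>Skip\<close> is within \<open>n ^ 3\<close>.\<close>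
    have "computes_embeddings_upto_cliques B P 1 Skip 1"
      unfolding computes_embeddings_upto_cliques_def
    proof (intro allI impI)
      fix w n :: nat and E and s :: state assume "1 \<le> n" "reg s B = 0"
      then show "terminates_within w Skip (1 * n ^ 3) (\<lambda>s'. same_below B 5 s s' \<and> reg s' B < 2 ^ w \<and>
        int (reg s' B) = (int (card (embeddings P ({..<n}, E))) -
          1 * int (card (embeddings ?K4 ({..<n}, E)))) mod 2 ^ w) s"
        using exec_Skip[of w s] P[symmetric] unfolding terminates_within_def
        by (intro exI[of _ 1] exI[of _ s]) (simp add: same_below_refl)
    qed
    then show ?thesis by (intro exI[of _ Skip] exI[of _ 1]) simp
  next
    case False
    then obtain e where e: "e \<subseteq> ?V" "card e = 2" "e \<notin> edges P" using sub by blast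
    then obtain i j where ij: "e = {i, j}" "i \<noteq> j" by (auto simp: card_2_iff)
    have "card (?V - e) = 2" using e less.prems finV finite_subset[OF e(1)] by (simp add: card_Diff_subset)
    then obtain k l where kl: "?V - e = {k, l}" "k \<noteq> l" by (auto simp: card_2_iff)
    have dist: "distinct [i, j, k, l]" using ij kl by auto
    have V: "?V = {i, j, k, l}" using ij kl e(1) by auto
    let ?P' = "(?V, insert {i, j} (edges P))"
    have P': "simple_graph ?P'" using less.prems e ij by (auto simp: simple_graph_def)
    have "card ({e. e \<subseteq> verts ?P' \<and> card e = 2} - edges ?P') < card ({e. e \<subseteq> ?V \<and> card e = 2} - edges P)"
    proof (rule psubset_card_mono)
      show "finite ({e. e \<subseteq> ?V \<and> card e = 2} - edges P)" using finV by simp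
      have "e \<in> {e. e \<subseteq> ?V \<and> card e = 2} - edges P" using e by simp
      moreover have "e \<in> edges ?P'" by (simp add: ij(1))
      ultimately show "{e. e \<subseteq> verts ?P' \<and> card e = 2} - edges ?P' \<subset> {e. e \<subseteq> ?V \<and> card e = 2} - edges P"
        unfolding fst_conv snd_conv by blast
    qed
    from less.hyps[OF this P'] less.prems(2) obtain c K \<sigma> where c: "register_only c"
      and \<sigma>: "\<sigma> \<in> {1, - 1 :: int}" and comp: "computes_embeddings_upto_cliques B ?P' \<sigma> c K"
      by auto
    note run = comp[unfolded computes_embeddings_upto_cliques_def fst_conv, rule_format]
    let ?count = "count_code B ({k, l} \<in> edges P) ({i, k} \<in> edges P) ({i, l} \<in> edges P)
      ({j, k} \<in> edges P) ({j, l} \<in> edges P)"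
    \<comment> \<open>\<open>count_code\<close> adds to the accumulator, so X is first replaced by
      -X, computed as zero minus X.\<close>
    let ?c = "Seq c (Seq (block [Op Sub B (B + 4) B]) ?count)"
    \<comment> \<open>Of the extra 72, 70 pay for \<open>count_code\<close> and 2 for the
      negation.\<close>
    have "computes_embeddings_upto_cliques B P (- \<sigma>) ?c (K + 72)"
      unfolding computes_embeddings_upto_cliques_def
    proof (intro allI impI)
      fix w n E s
      assume env: "env w B n E s" and E: "graph_on n E" and n: "1 \<le> n" and acc: "reg s B = 0"
      show "terminates_within w ?c ((K + 72) * n ^ 3) (\<lambda>s'. same_below B 5 s s' \<and> reg s' B < 2 ^ w \<and>
        int (reg s' B) = (int (card (embeddings P ({..<n}, E))) -
          (- \<sigma>) * int (card (embeddings ?K4 ({..<n}, E)))) mod 2 ^ w) s"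
      proof -
        let ?G = "({..<n}, E)"
        define X where "X = int (card (embeddings ?P' ?G)) - \<sigma> * int (card (embeddings ?K4 ?G))"
        define D where "D = open_pair_count ?G ({k, l} \<in> edges P) ({i, k} \<in> edges P) ({i, l} \<in> edges P)
          ({j, k} \<in> edges P) ({j, l} \<in> edges P)"
        have "int (card (embeddings P ?G)) + int (card (embeddings ?P' ?G)) = D"
          unfolding D_def using card_embeddings_add_edge[OF less.prems(1) V dist _ E[unfolded graph_on_def]] e ij
          by simp
        then have DX: "int (card (embeddings P ?G)) - (- \<sigma>) * int (card (embeddings ?K4 ?G)) = D - X"
          by (simp add: X_def)
        have tail: "terminates_within w (Seq (block [Op Sub B (B + 4) B]) ?count) (2 + 70 * n ^ 3)
            (\<lambda>s'. same_below B 5 s s' \<and> reg s' B < 2 ^ w \<and> int (reg s' B) = (D - X) mod 2 ^ w) s1"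
          if s1: "same_below B 5 s s1" "reg s1 B < 2 ^ w" "int (reg s1 B) = X mod 2 ^ w" for s1
        proof (rule terminates_within_Seq, rule terminates_within_block)
          define s2 where "s2 = fold (step w) [Op Sub B (B + 4) B] s1"
          have e1: "env w B n E s1" using env_same_below[OF env s1(1)] .
          have "reg s2 B = binop_val w Sub 0 (reg s1 B)"
            using e1 by (simp add: s2_def env_def del: binop_val.simps)
          then have r2: "int (reg s2 B) = (- X) mod 2 ^ w" "reg s2 B < 2 ^ w"
            using binop_val_Sub_int[OF s1(2), of 0] s1(3) by (simp_all add: mod_simps)
          have s12: "same_below B 5 s1 s2" by (simp add: same_below_def s2_def)
          then have e2: "env w B n E s2" using env_same_below[OF e1] by simp
          have s02: "same_below B 5 s s2" using same_below_trans[OF s1(1) s12] .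
          have "terminates_within w ?count (70 * n ^ 3)
            (\<lambda>s'. same_below B 5 s s' \<and> reg s' B < 2 ^ w \<and> int (reg s' B) = (D - X) mod 2 ^ w) s2"
            by (rule terminates_within_mono[OF count_code_effect[OF e2 E r2(2) n]])
              (use s02 in \<open>auto simp: r2(1) mod_simps D_def elim: same_below_trans\<close>)
          then show "terminates_within w ?count (70 * n ^ 3)
            (\<lambda>s'. same_below B 5 s s' \<and> reg s' B < 2 ^ w \<and> int (reg s' B) = (D - X) mod 2 ^ w)
            (fold (step w) [Op Sub B (B + 4) B] s1)" by (simp only: s2_def)
        qed simp_all
        have "terminates_within w c (K * n ^ 3)
          (terminates_within w (Seq (block [Op Sub B (B + 4) B]) ?count) (2 + 70 * n ^ 3)
            (\<lambda>s'. same_below B 5 s s' \<and> reg s' B < 2 ^ w \<and> int (reg s' B) = (D - X) mod 2 ^ w)) s"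
          by (rule terminates_within_mono[OF run[OF env E n acc] order_refl])
            (rule tail, simp_all add: X_def)
        from terminates_within_Seq[OF this] show ?thesis
          unfolding DX
        proof (rule terminates_within_mono)
          have "1 \<le> n ^ 3" using n by simp
          then show "K * n ^ 3 + (2 + 70 * n ^ 3) \<le> (K + 72) * n ^ 3"
            unfolding add_mult_distrib by linarith
        qed
      qed
    qed
    moreover have "register_only ?c" using c by (simp add: register_only_count_code register_only_block)
    moreover have "- \<sigma> \<in> {1, - 1}" using \<sigma> by auto
    ultimately show ?thesis by blast
  qed
qed

section \<open>Reduction from clique detection\<close>

lemma nth_concat_uniform:
  assumes "\<forall>xs\<in>set xss. length xs = k" "u < length xss" "v < k"
  shows "concat xss ! (u * k + v) = xss ! u ! v"
  using assms
proof (induction xss arbitrary: u)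
  case (Cons xs xss)
  then show ?case by (cases u) (auto simp: nth_append)
qed simp

lemma length_concat_pairs: "length (concat (map (\<lambda>(u, v). [u, v]) es)) = 2 * length es"
  by (induction es) auto

lemma length_encode_graph: "length (encode_graph n es) = 2 + 2 * length es + n * n"
proof -
  have "length (concat (map (\<lambda>u. map (f u) [0..<n]) us)) = length us * n" for f :: "nat \<Rightarrow> nat \<Rightarrow> nat" and us
    by (induction us) auto
  then show ?thesis by (simp add: encode_graph_def length_concat_pairs)
qed

text \<open>The offset skips two header cells and two cells per listed edge; the matrix follows row
  by row.\<close>

lemma nth_encode_graph_matrix:
  assumes "u < n" "v < n"
  shows "encode_graph n es ! (u * n + v + (2 + 2 * length es)) =
    of_bool ((u, v) \<in> set es \<or> (v, u) \<in> set es)"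
proof -
  define M where "M = map (\<lambda>u. map (\<lambda>v. of_bool ((u, v) \<in> set es \<or> (v, u) \<in> set es) :: nat) [0..<n]) [0..<n]"
  have "encode_graph n es = ([n, length es] @ concat (map (\<lambda>(u, v). [u, v]) es)) @ concat M"
    by (simp add: encode_graph_def M_def)
  moreover have "length ([n, length es] @ concat (map (\<lambda>(u, v). [u, v]) es)) = 2 + 2 * length es"
    by (simp add: length_concat_pairs)
  ultimately have "encode_graph n es ! (u * n + v + (2 + 2 * length es)) = concat M ! (u * n + v)"
    by (metis nth_append_length_plus add.commute)
  also have "\<dots> = M ! u ! v" using assms by (intro nth_concat_uniform) (auto simp: M_def)
  finally show ?thesis using assms by (simp add: M_def)
qed

lemma edge_listing_mem:
  assumes "edge_listing es E"
  shows "((u, v) \<in> set es \<or> (v, u) \<in> set es) \<longleftrightarrow> {u, v} \<in> E"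
proof -
  have "E = (\<lambda>i. {fst (es ! i), snd (es ! i)}) ` {..<length es}"
    using assms by (simp add: edge_listing_def bij_betw_def)
  also have "\<dots> = (\<lambda>e. {fst e, snd e}) ` set es"
    by (force simp: set_conv_nth)
  finally show ?thesis by (force simp: doubleton_eq_iff)
qed

lemma card_graph_on_le:
  assumes "graph_on n E"
  shows "card E \<le> n ^ 2"
proof -
  have "E \<subseteq> (\<lambda>(u, v). {u, v}) ` ({..<n} \<times> {..<n})"
  proof
    fix e assume "e \<in> E"
    then have "e \<subseteq> {..<n}" "card e = 2" using assms by (auto simp: graph_on_def simple_graph_def)
    then show "e \<in> (\<lambda>(u, v). {u, v}) ` ({..<n} \<times> {..<n})"
      by (auto simp: card_2_iff image_iff)
  qed
  then have "card E \<le> card ((\<lambda>(u, v). {u, v}) ` ({..<n} \<times> {..<n}))" by (intro card_mono) auto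
  also have "\<dots> \<le> card ({..<n} \<times> {..<n})" by (rule card_image_le) simp
  finally show ?thesis by (simp add: power2_eq_square)
qed

text \<open>This is where \<open>4 \<le> \<kappa>\<close> enters. The base \<open>n + 1\<close>
  leaves room strictly above the at most \<open>n ^ 4\<close> embeddings of a four-vertex graph, and
  above all input addresses.\<close>

lemma power_word_size_ge:
  assumes "4 \<le> \<kappa>" "1 \<le> n"
  shows "(n + 1) ^ 4 \<le> 2 ^ word_size \<kappa> n"
proof -
  have "n < 2 ^ floorlog 2 n" using floorlog_bounds[of n 2] assms by simp
  then have "(n + 1) ^ 4 \<le> (2 ^ floorlog 2 n) ^ 4" by (intro power_mono) auto
  also have "\<dots> = 2 ^ (4 * floorlog 2 n)" by (simp add: power_mult[symmetric] mult.commute)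
  also have "\<dots> \<le> 2 ^ word_size \<kappa> n"
    unfolding word_size_def using assms by (intro power_increasing) auto
  finally show ?thesis .
qed

text \<open>Cells 0 and 1 hold \<open>n\<close> and the number of edges. Doubling the latter and
  adding one twice yields the address at which the matrix starts.\<close>

definition setup_code :: "nat \<Rightarrow> com list" where
  "setup_code B = [Const (B + 4) 0, Const (B + 2) 1, Load (B + 1) (B + 4), Load (B + 3) (B + 2),
     Op Add (B + 3) (B + 3) (B + 3), Op Add (B + 3) (B + 3) (B + 2), Op Add (B + 3) (B + 3) (B + 2)]"

lemma setup_code_env:
  fixes \<omega> :: "bool stream" and B :: nat
  assumes \<kappa>: "4 \<le> \<kappa>" and n: "1 \<le> n" and E: "graph_on n E" and es: "edge_listing es E"
  defines "s \<equiv> fold (step (word_size \<kappa> n)) (setup_code B) (init_state n es \<omega>)"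
  shows "env (word_size \<kappa> n) B n E s" and "reg s B = 0" and "\<And>r. r < B \<Longrightarrow> reg s r = 0"
    and "mem s = mem (init_state n es \<omega>)" and "coins s = \<omega>"
proof -
  let ?w = "word_size \<kappa> n" and ?s0 = "init_state n es \<omega>" and ?m = "length es"
  have "card {..<?m} = card E" using es unfolding edge_listing_def by (rule bij_betw_same_card)
  then have m: "?m \<le> n ^ 2" using card_graph_on_le[OF E] by simp
  \<comment> \<open>The input occupies at most 2 + 3 n^2 cells, which the lower binomial terms
    already exceed.\<close>
  have "(n + 1) ^ 4 = n ^ 4 + 4 * n ^ 3 + 6 * n ^ 2 + 4 * n + 1"
    by (simp add: eval_nat_numeral algebra_simps)
  with power_word_size_ge[OF \<kappa> n] n have big: "6 * n ^ 2 + 4 * n + 1 \<le> 2 ^ ?w" by linarith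
  have w0: "0 < ?w" using \<kappa> n by (simp add: word_size_def floorlog_def)
  have le: "2 + 2 * ?m + n * n < 2 ^ ?w" "n < 2 ^ ?w"
    using big m n by (auto simp: power2_eq_square)
  have mods: "(?m + ?m) mod 2 ^ ?w = ?m + ?m" "Suc (?m + ?m) mod 2 ^ ?w = Suc (?m + ?m)"
    "Suc (Suc (?m + ?m)) mod 2 ^ ?w = Suc (Suc (?m + ?m))" "Suc 0 mod 2 ^ ?w = Suc 0"
    using le w0 by auto
  have mem0: "mem ?s0 0 = n" "mem ?s0 (Suc 0) = ?m"
    using length_encode_graph[of n es] by (simp_all add: init_state_def encode_graph_def)
  have reg_s: "reg s = (reg ?s0)(B + 4 := 0, B + 2 := 1, B + 1 := n, B + 3 := 2 + 2 * ?m)"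
    and mem_s: "mem s = mem ?s0" and coins_s: "coins s = coins ?s0"
    using w0 by (simp_all add: s_def setup_code_def mem0 mods mult_2)
  have "u * n + v + (2 + 2 * ?m) < 2 ^ ?w \<and>
    mem ?s0 (u * n + v + (2 + 2 * ?m)) = of_bool ({u, v} \<in> E)" if uv: "u < n" "v < n" for u v
  proof -
    have "u * n + v < n * n"
    proof -
      have "Suc u * n \<le> n * n" using uv by (intro mult_le_mono1) simp
      then show ?thesis using uv by simp
    qed
    then show ?thesis
      using le nth_encode_graph_matrix[OF uv, of es] edge_listing_mem[OF es, of u v]
      by (simp add: init_state_def length_encode_graph)
  qed
  then show "env ?w B n E s" using le w0 unfolding env_def by (simp add: reg_s mem_s)
  show "reg s B = 0" "\<And>r. r < B \<Longrightarrow> reg s r = 0" by (simp_all add: reg_s init_state_def)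
  show "mem s = mem ?s0" "coins s = \<omega>" by (simp_all add: mem_s coins_s init_state_def)
qed

text \<open>The correction term is computed before the dynamic algorithm starts, in registers which that
  algorithm does not mention, because the algorithm may overwrite the input.\<close>
lemma clique_code_exists:
  fixes P :: "'a graph"
  assumes notion: "combinatorial_notion \<C>" and P: "simple_graph P" "card (verts P) = 4"
    and A: "combinatorial_dyn \<C> A" and \<kappa>: "4 \<le> \<kappa>"
  obtains c K where "c \<in> \<C>"
    and "\<And>n E es \<omega> t rs. 1 \<le> n \<Longrightarrow> graph_on n E \<Longrightarrow> edge_listing es E \<Longrightarrow>
      session (word_size \<kappa> n) A n es [Query] \<omega> t rs \<Longrightarrow>
      \<exists>t' s. exec (word_size \<kappa> n) c (init_state n es \<omega>) t' s \<and>
        t' \<le> K * n ^ 3 + t + fst (rs ! 0) \<and>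
        (snd (rs ! 0) = c_I ({..<n}, E) P \<longrightarrow> (reg s 0 \<noteq> 0 \<longleftrightarrow> has_clique 4 ({..<n}, E)))"
proof -
  \<comment> \<open>The \<open>Suc\<close> keeps the accumulator \<open>B\<close> apart from
    register 0, where answers are returned, even if the algorithm mentions no register.\<close>
  define B where "B = Suc (max (reg_bound (pre A)) (reg_bound (qry A)))"
  have B: "reg_bound (pre A) \<le> B" "reg_bound (qry A) \<le> B" "0 < B" by (auto simp: B_def)
  let ?K4 = "complete_graph (verts P)"
  obtain c K \<sigma> where c: "register_only c" and \<sigma>: "\<sigma> \<in> {1, - 1 :: int}"
    and comp: "computes_embeddings_upto_cliques B P \<sigma> c K"
    using embeddings_code_exists[OF P, of B] by blast
  note run = comp[unfolded computes_embeddings_upto_cliques_def, rule_format]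
  define q where "q = card (embeddings P P)"
  \<comment> \<open>Turns the induced count in register 0 into a count of embeddings and subtracts
    the correction term; what remains is \<open>\<sigma>\<close> times the number of clique
    embeddings.\<close>
  let ?fin = "[Const (B + 1) q, Op Mul 0 0 (B + 1), Op Sub 0 0 B]"
  define c' where "c' = Seq (block (setup_code B)) (Seq c (Seq (pre A) (Seq (qry A) (block ?fin))))"
  have "register_only (block (setup_code B))" "register_only (block ?fin)"
    by (simp_all add: register_only_block setup_code_def)
  then have "c' \<in> \<C>"
    using notion A c by (simp add: c'_def combinatorial_notion_def combinatorial_dyn_def)
  \<comment> \<open>The extra 12 covers 8 steps of setup and 4 of the final block.\<close>
  moreover have "\<exists>t' s. exec (word_size \<kappa> n) c' (init_state n es \<omega>) t' s \<and>
        t' \<le> (K + 12) * n ^ 3 + t + fst (rs ! 0) \<and>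
        (snd (rs ! 0) = c_I ({..<n}, E) P \<longrightarrow> (reg s 0 \<noteq> 0 \<longleftrightarrow> has_clique 4 ({..<n}, E)))"
    if n: "1 \<le> n" and E: "graph_on n E" and es: "edge_listing es E"
      and ses: "session (word_size \<kappa> n) A n es [Query] \<omega> t rs" for n E es \<omega> t rs
  proof -
    let ?w = "word_size \<kappa> n" and ?s0 = "init_state n es \<omega>" and ?G = "({..<n}, E)"
    obtain sp sq tq where pre: "exec ?w (pre A) ?s0 t sp" and qry: "exec ?w (qry A) sp tq sq"
      and rs: "rs ! 0 = (tq, reg sq 0)"
      using ses unfolding session_def by (force elim: runs.cases)
    define s1 where "s1 = fold (step ?w) (setup_code B) ?s0"
    note s1 = setup_code_env[OF \<kappa> n E es, where B = B and \<omega> = \<omega>, folded s1_def]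
    have "terminates_within ?w (block (setup_code B)) 8 (\<lambda>s. s = s1) ?s0"
      by (rule terminates_within_block) (simp_all add: s1_def, simp_all add: setup_code_def)
    then obtain t1 where t1: "exec ?w (block (setup_code B)) ?s0 t1 s1" "t1 \<le> 8"
      unfolding terminates_within_def by blast
    obtain t2 s2 where t2: "exec ?w c s1 t2 s2" "t2 \<le> K * n ^ 3" and s2: "same_below B 5 s1 s2"
      "reg s2 B < 2 ^ ?w" "int (reg s2 B) = (int (card (embeddings P ?G)) -
        \<sigma> * int (card (embeddings ?K4 ?G))) mod 2 ^ ?w"
      using run[OF s1(1) E n s1(2)] unfolding terminates_within_def by blast
    \<comment> \<open>Below \<open>B\<close> all registers are still 0, memory is unchanged and no
      coin has been read. Hence the algorithm behaves as from \<open>?s0\<close>, with the same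
      coins and the same running times.\<close>
    have "s2 = override_from B (reg s2) ?s0"
      using s2(1) s1(3-5) by (intro state_eqI ext) (auto simp: same_below_def override_from_def init_state_def)
    with exec_override_from[OF pre B(1), of "reg s2"] exec_override_from[OF qry B(2), of "reg s2"]
    have pre': "exec ?w (pre A) s2 t (override_from B (reg s2) sp)"
      and qry': "exec ?w (qry A) (override_from B (reg s2) sp) tq (override_from B (reg s2) sq)"
      by simp_all
    let ?s3 = "override_from B (reg s2) sq"
    define s4 where "s4 = fold (step ?w) ?fin ?s3"
    have "terminates_within ?w (block ?fin) 4 (\<lambda>s. s = s4) ?s3"
      by (rule terminates_within_block) (simp_all only: s4_def, simp_all)
    then obtain t4 where t4: "exec ?w (block ?fin) ?s3 t4 s4" "t4 \<le> 4"
      unfolding terminates_within_def by blast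
    have "exec ?w c' ?s0 (t1 + (t2 + (t + (tq + t4)))) s4"
      unfolding c'_def by (intro exec_Seq) (fact t1 t2 pre' qry' t4)+
    moreover have "t1 + (t2 + (t + (tq + t4))) \<le> (K + 12) * n ^ 3 + t + fst (rs ! 0)"
    proof -
      have "1 \<le> n ^ 3" using n by simp
      with t1(2) t2(2) t4(2) show ?thesis unfolding add_mult_distrib rs fst_conv by linarith
    qed
    moreover have "reg s4 0 \<noteq> 0 \<longleftrightarrow> has_clique 4 ?G" if ans: "snd (rs ! 0) = c_I ?G P"
    proof -
      define N where "N = card (embeddings ?K4 ?G)"
      have G: "simple_graph ?G" using E by (simp add: graph_on_def)
      have finP: "finite (verts P)" using P(1) by (simp add: simple_graph_def)
      \<comment> \<open>\<open>Const\<close> truncates \<open>q\<close>, which can reach 24 while a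
        word may have only 4 bits; the product is used only modulo \<open>2 ^ ?w\<close>, so this is
        harmless.\<close>
      have "reg s4 0 = binop_val ?w Sub ((reg sq 0 * (q mod 2 ^ ?w)) mod 2 ^ ?w) (reg s2 B)"
        using B(3) by (simp add: s4_def del: binop_val.simps(2))
      then have "int (reg s4 0) =
          (int ((reg sq 0 * (q mod 2 ^ ?w)) mod 2 ^ ?w) - int (reg s2 B)) mod 2 ^ ?w"
        by (simp only: binop_val_Sub_int[OF s2(2)])
      also have "\<dots> = (int (q * reg sq 0) - (int (card (embeddings P ?G)) - \<sigma> * int N)) mod 2 ^ ?w"
        by (simp add: s2(3) of_nat_mod mod_simps N_def mult.commute)
      also have "q * reg sq 0 = card (embeddings P ?G)"
        using ans rs card_embeddings_eq_c_I[OF finP, of ?G] by (simp add: q_def)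
      finally have r4: "int (reg s4 0) = (\<sigma> * int N) mod 2 ^ ?w" by simp
      have "N \<le> n ^ 4"
        using card_embeddings_le[of ?K4 ?G] finP P(2) by (simp add: N_def complete_graph_def)
      also have "n ^ 4 < (n + 1) ^ 4" by (intro power_strict_mono) auto
      also have "\<dots> \<le> 2 ^ ?w" by (rule power_word_size_ge[OF \<kappa> n])
      finally have "N < 2 ^ ?w" .
      then have "(2 :: int) ^ ?w dvd int N \<longleftrightarrow> N = 0"
        by (metis dvd_0_right nat_dvd_not_less neq0_conv of_nat_0 of_nat_dvd_iff of_nat_numeral of_nat_power)
      moreover have "int (reg s4 0) = 0 \<longleftrightarrow> (2 :: int) ^ ?w dvd \<sigma> * int N"
        by (simp only: r4 mod_eq_0_iff_dvd)
      moreover have "(2 :: int) ^ ?w dvd \<sigma> * int N \<longleftrightarrow> (2 :: int) ^ ?w dvd int N" using \<sigma> by auto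
      ultimately have "reg s4 0 = 0 \<longleftrightarrow> N = 0" by (simp only: of_nat_eq_0_iff)
      also have "\<dots> \<longleftrightarrow> embeddings ?K4 ?G = {}"
        using finite_embeddings[of ?K4 ?G] finP by (simp add: N_def complete_graph_def)
      also have "\<dots> \<longleftrightarrow> \<not> has_clique 4 ?G"
        using embeddings_complete_eq_empty_iff[OF G finP] P(2) by simp
      finally show ?thesis by simp
    qed
    ultimately show ?thesis by blast
  qed
  ultimately show thesis by (rule that)
qed

text \<open>The exponent \<open>e\<close> may be negative, where \<open>powr\<close> is not
  increasing in its base; it is raised to the nonnegative \<open>e'\<close> before m is replaced by
  n^2, which doubles it.\<close>

lemma m_bound_le:
  assumes "graph_on n E" "1 \<le> n" "e \<le> e'" "0 \<le> e'"
  shows "m_bound E e \<le> real n powr (2 * e')"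
proof -
  have "real (max 1 (card E)) powr e \<le> real (max 1 (card E)) powr e'"
    using assms by (intro powr_mono) auto
  also have "\<dots> \<le> real (n ^ 2) powr e'"
    using card_graph_on_le[OF assms(1)] assms(2,4) by (intro powr_mono2) auto
  also have "\<dots> = real n powr (2 * e')"
  proof -
    have "real (n ^ 2) = real n powr 2" by simp
    then show ?thesis by (simp only: powr_powr)
  qed
  finally show ?thesis by (simp add: m_bound_def)
qed

theorem theorem4p1:
  fixes \<C> :: "com set" and P :: "'a graph" and \<gamma> :: real
  assumes "combinatorial_notion \<C>"
    and "simple_graph P" and "card (verts P) = 4" and "connected_graph P"
    and "\<gamma> > 0"
    and "combinatorial_clique_conjecture \<C> 4"
  shows "\<not> (\<exists>md \<in> {Incremental, Fully_Dynamic}. \<exists>\<kappa>\<ge>4. \<exists>A. combinatorial_dyn \<C> A \<and>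
           maintains_c_I md P \<kappa> A (2 - \<gamma>) (1 - \<gamma>) (2 - \<gamma>))"
proof
  assume "\<exists>md \<in> {Incremental, Fully_Dynamic}. \<exists>\<kappa>\<ge>4. \<exists>A. combinatorial_dyn \<C> A \<and>
           maintains_c_I md P \<kappa> A (2 - \<gamma>) (1 - \<gamma>) (2 - \<gamma>)"
  then obtain md \<kappa> A where \<kappa>: "4 \<le> \<kappa>" and A: "combinatorial_dyn \<C> A"
    and maint: "maintains_c_I md P \<kappa> A (2 - \<gamma>) (1 - \<gamma>) (2 - \<gamma>)" by blast
  obtain c K where c: "c \<in> \<C>"
    and run: "\<And>n E es \<omega> t rs. 1 \<le> n \<Longrightarrow> graph_on n E \<Longrightarrow> edge_listing es E \<Longrightarrow>
      session (word_size \<kappa> n) A n es [Query] \<omega> t rs \<Longrightarrow>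
      \<exists>t' s. exec (word_size \<kappa> n) c (init_state n es \<omega>) t' s \<and>
        t' \<le> K * n ^ 3 + t + fst (rs ! 0) \<and>
        (snd (rs ! 0) = c_I ({..<n}, E) P \<longrightarrow> (reg s 0 \<noteq> 0 \<longleftrightarrow> has_clique 4 ({..<n}, E)))"
    using clique_code_exists[OF assms(1-3) A \<kappa>] by metis
  have after: "graph_after E [Query] 0 = E" for E by (simp add: graph_after_def)
  obtain C where C: "\<And>n E es. 1 \<le> n \<Longrightarrow> graph_on n E \<Longrightarrow> edge_listing es E \<Longrightarrow>
      (\<forall>\<omega>. \<exists>t rs. session (word_size \<kappa> n) A n es [Query] \<omega> t rs \<and>
        real t \<le> C * m_bound E (2 - \<gamma>) \<and> real (fst (rs ! 0)) \<le> C * m_bound E (2 - \<gamma>)) \<and>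
      measure coin_space {\<omega>. \<exists>t rs. session (word_size \<kappa> n) A n es [Query] \<omega> t rs \<and>
          snd (rs ! 0) = c_I ({..<n}, E) P} \<ge> 2 / 3"
  proof -
    obtain C where "\<forall>n\<ge>1. \<forall>E es ops. graph_on n E \<and> edge_listing es E \<and> valid_ops md n E ops \<longrightarrow>
     (\<forall>\<omega>. \<exists>t rs. session (word_size \<kappa> n) A n es ops \<omega> t rs \<and>
        real t \<le> C * m_bound E (2 - \<gamma>) \<and>
        (\<Sum>i | i < length ops \<and> is_update (ops ! i). real (fst (rs ! i)))
          \<le> C * (\<Sum>i | i < length ops \<and> is_update (ops ! i). m_bound (graph_after E ops i) (1 - \<gamma>)) \<and>
        (\<forall>i<length ops. ops ! i = Query \<longrightarrow>
           real (fst (rs ! i)) \<le> C * m_bound (graph_after E ops i) (2 - \<gamma>))) \<and>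
     (\<forall>i<length ops. ops ! i = Query \<longrightarrow>
        measure coin_space {\<omega>. \<exists>t rs. session (word_size \<kappa> n) A n es ops \<omega> t rs \<and>
          snd (rs ! i) = c_I ({..<n}, graph_after E ops i) P} \<ge> 2 / 3)"
      using maint unfolding maintains_c_I_def by blast
    \<comment> \<open>A lone query is a valid sequence of operations in either mode, so one argument
      serves both.\<close>
    note * = this[rule_format, where ops = "[Query]"]
    show thesis
    proof (rule that[of C], intro conjI allI)
      fix n E es \<omega> assume "1 \<le> n" "graph_on n E" "edge_listing es E"
      then have **: "1 \<le> n" "graph_on n E \<and> edge_listing es E \<and> valid_ops md n E [Query]" by simp_all
      show "\<exists>t rs. session (word_size \<kappa> n) A n es [Query] \<omega> t rs \<and>
        real t \<le> C * m_bound E (2 - \<gamma>) \<and> real (fst (rs ! 0)) \<le> C * m_bound E (2 - \<gamma>)"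
        using conjunct1[OF *[OF **]] by (fastforce simp: after)
      show "measure coin_space {\<omega>. \<exists>t rs. session (word_size \<kappa> n) A n es [Query] \<omega> t rs \<and>
          snd (rs ! 0) = c_I ({..<n}, E) P} \<ge> 2 / 3"
        using conjunct2[OF *[OF **], rule_format, of 0] by (simp add: after)
    qed
  qed
  \<comment> \<open>The term 2 \<gamma> comes from m \<le> n^2; the cap 1 keeps the exponent 4 -
    \<delta> at least 3, so that the cubic counting fits as well.\<close>
  define \<delta> where "\<delta> = min 1 (2 * \<gamma>)"
  have \<delta>: "0 < \<delta>" "\<delta> \<le> 1" "\<delta> \<le> 2 * \<gamma>" using assms(5) by (auto simp: \<delta>_def)
  have "detects_clique 4 \<kappa> c (real 4 - \<delta>)"
    unfolding detects_clique_def
  \<comment> \<open>\<open>K\<close> pays for the counting and twice \<bar>C\<bar> for preprocessing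
    and query; the absolute value is taken because the sign of \<open>C\<close> is not
    given.\<close>
  proof (intro exI[of _ "real K + 2 * \<bar>C\<bar>"] allI impI, elim conjE, intro conjI allI)
    fix n :: nat and E es assume n: "1 \<le> n" and E: "graph_on n E" and es: "edge_listing es E"
    note C = C[OF n E es] and run = run[OF n E es]
    show "\<exists>t s. exec (word_size \<kappa> n) c (init_state n es \<omega>) t s \<and>
      real t \<le> (real K + 2 * \<bar>C\<bar>) * real n powr (real 4 - \<delta>)" for \<omega>
    proof -
      obtain t rs where t: "session (word_size \<kappa> n) A n es [Query] \<omega> t rs"
        "real t \<le> C * m_bound E (2 - \<gamma>)" "real (fst (rs ! 0)) \<le> C * m_bound E (2 - \<gamma>)"
        using conjunct1[OF C] by blast
      obtain t' s where t': "exec (word_size \<kappa> n) c (init_state n es \<omega>) t' s"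
        "t' \<le> K * n ^ 3 + t + fst (rs ! 0)" using run[OF t(1)] by blast
      \<comment> \<open>The exponent 2 - \<delta> / 2 is at least 2 - \<gamma> and positive, and its
        double is 4 - \<delta>.\<close>
      have "m_bound E (2 - \<gamma>) \<le> real n powr (2 * (2 - \<delta> / 2))"
        using \<delta> by (intro m_bound_le[OF E n]) auto
      then have mb: "m_bound E (2 - \<gamma>) \<le> real n powr (4 - \<delta>)" by (simp add: algebra_simps)
      have "C * m_bound E (2 - \<gamma>) \<le> \<bar>C\<bar> * real n powr (4 - \<delta>)"
        using mb by (intro mult_mono) (auto simp: m_bound_def)
      moreover have "real (n ^ 3) \<le> real n powr (4 - \<delta>)"
        using n \<delta> powr_mono[of 3 "4 - \<delta>" "real n"] by simp
      then have "real K * real (n ^ 3) \<le> real K * real n powr (4 - \<delta>)" by (intro mult_left_mono) auto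
      moreover have "real t' \<le> real K * real (n ^ 3) + real t + real (fst (rs ! 0))"
        using t'(2) by (metis of_nat_add of_nat_le_iff of_nat_mult)
      ultimately have "real t' \<le> (real K + 2 * \<bar>C\<bar>) * real n powr (real 4 - \<delta>)"
        using t(2,3) by (simp add: algebra_simps)
      with t'(1) show ?thesis by blast
    qed
    interpret prob_space coin_space
      unfolding coin_space_def by (rule prob_space.prob_space_stream_space) (rule prob_space_measure_pmf)
    have "2 / 3 \<le> measure coin_space {\<omega>. \<exists>t rs. session (word_size \<kappa> n) A n es [Query] \<omega> t rs \<and>
        snd (rs ! 0) = c_I ({..<n}, E) P}" using conjunct2[OF C] .
    also have "\<dots> \<le> measure coin_space {\<omega>. \<exists>t s. exec (word_size \<kappa> n) c (init_state n es \<omega>) t s \<and>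
        (reg s 0 \<noteq> 0 \<longleftrightarrow> has_clique 4 ({..<n}, E))}"
      \<comment> \<open>The inclusion holds for each coin sequence separately: a correct session
        gives a correct run of \<open>c\<close>. Monotonicity asks for measurability of the larger
        event, supplied by \<open>sets_coin_space_exec_outcome\<close>.\<close>
      using run by (intro finite_measure_mono sets_coin_space_exec_outcome) blast
    finally show "2 / 3 \<le> measure coin_space {\<omega>. \<exists>t s. exec (word_size \<kappa> n) c (init_state n es \<omega>) t s \<and>
        (reg s 0 \<noteq> 0 \<longleftrightarrow> has_clique 4 ({..<n}, E))}" .
  qed
  then show False
    using assms(6) \<kappa> c \<delta>(1) unfolding combinatorial_clique_conjecture_def by blast
qed

end
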